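(* Let $\Delta_u(d,n)$ denote the maximum diameter of the graph of a $d$-dimensional polyhedron with $n$ facets. For $n \geq d \geq 3$, \[\Delta_u(d,n) \leq \sum_{i=0}^{\lfloor \log (n/d)\rfloor} 2^i\, \Delta_u\!\left(d-1,\lfloor n/2^i\rfloor\right)-1.\]
   Context: A polyhedron is the intersection of finitely many closed halfspaces; $d$ is the dimension of its affine span and $n$ the number of its facets. The diameter is the maximum over pairs of vertices of the edge-distance in the graph (1-skeleton). $\Delta_u(d,n)$ is defined for $n \geq d$. All logarithms are base $2$. *)

theory Defs
  imports "HOL-Analysis.Analysis"
begin

text \<open>
  Vertices are extreme points (zero-dimensional faces).  Only bounded edges join two vertices;
  rays contribute nothing to the graph.
\<close>

definition poly_vertices :: "'a::euclidean_space set \<Rightarrow> 'a set" where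
  "poly_vertices P = {v. v extreme_point_of P}"

definition poly_adj :: "'a::euclidean_space set \<Rightarrow> 'a \<Rightarrow> 'a \<Rightarrow> bool" where
  "poly_adj P v w \<longleftrightarrow>
     v \<in> poly_vertices P \<and> w \<in> poly_vertices P \<and> v \<noteq> w \<and> closed_segment v w edge_of P"

text \<open>
  Distances and diameters are extended naturals: the distance is infinite when no path exists,
  and the diameter of the empty graph (a polyhedron without vertices) is \<open>0\<close>.
\<close>

definition graph_dist :: "'a::euclidean_space set \<Rightarrow> 'a \<Rightarrow> 'a \<Rightarrow> enat" where
  "graph_dist P v w = (INF k \<in> {k. (poly_adj P ^^ k) v w}. enat k)"

definition graph_diameter :: "'a::euclidean_space set \<Rightarrow> enat" where
  "graph_diameter P = (SUP v \<in> poly_vertices P. SUP w \<in> poly_vertices P. graph_dist P v w)"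

definition polyhedra :: "nat \<Rightarrow> nat \<Rightarrow> 'a::euclidean_space set set" where
  "polyhedra d n = {P. polyhedron P \<and> aff_dim P = int d \<and> card {F. F facet_of P} = n}"

text \<open>
  The \<open>d\<close>-dimensional polyhedra live in an ambient Euclidean space \<open>'a\<close> and need not be
  full-dimensional, so that different values of \<open>d\<close> can be compared in one space.  Since
  everything is invariant under affine isomorphism, the value does not depend on \<open>'a\<close> as long as
  \<open>d \<le> DIM('a)\<close>.  A supremum of extended naturals over a nonempty set is a maximum whenever it is
  finite.
\<close>

definition Delta_u :: "'a::euclidean_space itself \<Rightarrow> nat \<Rightarrow> nat \<Rightarrow> enat" where
  "Delta_u _ d n = (SUP P \<in> (polyhedra d n :: 'a set set). graph_diameter P)"

end

theory Submission
  imports Defs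
begin

text \<open>
  Write \<open>D = \<Delta> + 1\<close>.  The Kalai--Kleitman argument gives
  \<open>D(d, n) \<le> D(d - 1, n - 1) + 2 D(d, \<lfloor>n/2\<rfloor>)\<close>: two vertices, each allowed to walk until it has met more than
  half of the facets, reach a common facet, and the walk before this threshold is as long as in the
  polyhedron defined by the facets met so far.  The recursion stops below \<open>d\<close> facets, where no vertex
  exists, so the claimed bound follows from the strict monotonicity
  \<open>\<Delta>\<^sub>u(m, n) + 1 \<le> \<Delta>\<^sub>u(m, n + 1)\<close> for \<open>m \<ge> 2\<close>.

  For strict monotonicity, truncating a vertex \<open>v\<close> at distance \<open>k\<close> from \<open>u\<close> creates only vertices at
  distance at least \<open>k\<close>, and one at distance \<open>k + 1\<close> if \<open>v\<close> lies on an unbounded edge.  The latter is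
  arranged by a projective map that sends to infinity a hyperplane crossing an edge at \<open>v\<close>.  If the
  hyperplane is a level set of a functional bounded below on the polyhedron, all old points at infinity
  are cut off and no facet is added.  Such a functional is available for \<open>v\<close> or, after exchanging
  the roles, for \<open>u\<close>.
\<close>

section \<open>Vertices and edges of solution sets of linear inequalities\<close>

text \<open>A common facet has at most n - 1 facets of its own, so strict monotonicity absorbs its
  \<open>+ 1\<close>: D(d - 1, n - 1) = Delta_u(d - 1, n - 1) + 1 \<le> Delta_u(d - 1, n). Every
  level of the recursion then contributes a plain Delta_u(d - 1, _), and the single - 1 of the
  theorem is the step from D back to Delta_u. Monotonicity is applied in dimension d - 1, which is
  where d \<ge> 3 enters: on a line it fails, as no polyhedron there has three facets. It is not
  automatic in higher dimension either, because \<open>Delta_u\<close> prescribes the exact number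
  of facets, whereas the facets and relaxations that occur only have at most so many.

  Polyhedra are handled through systems of inequalities relative to their affine hull, so that
  facets, truncations and relaxations all live in the same ambient space. Vertices and edges are
  read off from the common kernel of the active normals; they therefore persist when inequalities
  inactive there are added or dropped, which is the common mechanism behind truncation and
  relaxation.\<close>

definition hpoly :: "('a::euclidean_space \<times> real) set \<Rightarrow> 'a set" where
  "hpoly S = {x. \<forall>h\<in>S. fst h \<bullet> x \<le> snd h}"

definition active :: "('a::euclidean_space \<times> real) set \<Rightarrow> 'a \<Rightarrow> ('a \<times> real) set" where
  "active S x = {h \<in> S. fst h \<bullet> x = snd h}"

text \<open>The directions along which all inequalities in \<open>H\<close> keep their slack. For
  the active inequalities this space is zero at a vertex and a line inside an edge.\<close>

definition annih :: "('a::euclidean_space \<times> real) set \<Rightarrow> 'a set" where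
  "annih H = {z. \<forall>h\<in>H. fst h \<bullet> z = 0}"

lemma hpolyD: "x \<in> hpoly S \<Longrightarrow> h \<in> S \<Longrightarrow> fst h \<bullet> x \<le> snd h"
  by (auto simp: hpoly_def)

lemma hpoly_Un: "hpoly (S \<union> T) = hpoly S \<inter> hpoly T"
  by (auto simp: hpoly_def)

lemma hpoly_insert: "hpoly (insert h S) = {x. fst h \<bullet> x \<le> snd h} \<inter> hpoly S"
  by (auto simp: hpoly_def)

lemma hpoly_mono: "S \<subseteq> T \<Longrightarrow> hpoly T \<subseteq> hpoly S"
  by (auto simp: hpoly_def)

lemma active_subset: "active S x \<subseteq> S"
  by (auto simp: active_def)

lemma finite_active: "finite S \<Longrightarrow> finite (active S x)"
  by (auto simp: active_def)

lemma annih_antimono: "H \<subseteq> K \<Longrightarrow> annih K \<subseteq> annih H"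
  by (auto simp: annih_def)

lemma hpoly_eq_Inter: "hpoly S = (\<Inter>h\<in>S. {x. fst h \<bullet> x \<le> snd h})"
  by (auto simp: hpoly_def)

lemma polyhedron_hpoly: "finite S \<Longrightarrow> polyhedron (hpoly S)"
  unfolding hpoly_eq_Inter by (rule polyhedron_Inter) (auto simp: polyhedron_halfspace_le)

lemma convex_hpoly: "convex (hpoly S)"
  unfolding hpoly_eq_Inter by (rule convex_Inter) (auto simp: convex_halfspace_le)

lemma closed_hpoly: "closed (hpoly S)"
  unfolding hpoly_eq_Inter by (rule closed_Inter) (auto simp: closed_halfspace_le)

section \<open>Symmetric perturbations inside convex sets\<close>

lemma convex_mem_between:
  fixes x z :: "'a::real_vector"
  assumes "convex S" "x \<in> S" "x + t *\<^sub>R z \<in> S" "0 \<le> s" "s \<le> t"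
  shows "x + s *\<^sub>R z \<in> S"
proof (cases "t = 0")
  case True then show ?thesis using assms by auto
next
  case False
  then have t: "t > 0" using assms by auto
  have "(1 - s/t) *\<^sub>R x + (s/t) *\<^sub>R (x + t *\<^sub>R z) \<in> S"
    using assms t by (intro convexD) auto
  moreover have "(1 - s/t) *\<^sub>R x + (s/t) *\<^sub>R (x + t *\<^sub>R z) = x + s *\<^sub>R z"
    using t by (simp add: algebra_simps)
  ultimately show ?thesis by simp
qed

lemma open_segment_symmetric_bounds:
  fixes x :: "'a::euclidean_space"
  assumes "x \<in> open_segment a b"
  obtains e where "e > 0" "x + e *\<^sub>R (b - a) \<in> closed_segment a b"
    "x - e *\<^sub>R (b - a) \<in> closed_segment a b"
proof -
  obtain u where u: "0 < u" "u < 1" "x = (1 - u) *\<^sub>R a + u *\<^sub>R b" "a \<noteq> b"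
    using assms by (auto simp: in_segment)
  define e where "e = min u (1 - u)"
  have "x + e *\<^sub>R (b - a) = (1 - (u + e)) *\<^sub>R a + (u + e) *\<^sub>R b"
    "x - e *\<^sub>R (b - a) = (1 - (u - e)) *\<^sub>R a + (u - e) *\<^sub>R b"
    using u by (auto simp: algebra_simps)
  moreover have "0 < e" "0 \<le> u + e" "u + e \<le> 1" "0 \<le> u - e" "u - e \<le> 1"
    using u by (auto simp: e_def)
  ultimately show ?thesis using that[of e] unfolding in_segment by blast
qed

lemma mid_in_open_segment:
  fixes x z :: "'a::euclidean_space"
  assumes "z \<noteq> 0"
  shows "x \<in> open_segment (x - z) (x + z)"
proof -
  have "x = (1 - 1/2) *\<^sub>R (x - z) + (1/2) *\<^sub>R (x + z)"
    by (simp add: algebra_simps flip: scaleR_2)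
  moreover have "x - z \<noteq> x + z"
  proof
    assume "x - z = x + z"
    then have "2 *\<^sub>R z = 0" unfolding scaleR_2 by (metis add_diff_cancel_left' cancel_ab_semigroup_add_class.diff_right_commute diff_add_cancel diff_self)
    then show False using assms by simp
  qed
  ultimately show ?thesis unfolding in_segment by (intro conjI exI[of _ "1/2"]) auto
qed

text \<open>Only segments centred at \<open>x\<close> need testing, since any open segment through
  \<open>x\<close> contains a short symmetric one. This is the form in which active constraints give
  information.\<close>

lemma extreme_iff_mid:
  fixes x :: "'a::euclidean_space"
  assumes "convex S"
  shows "x extreme_point_of S \<longleftrightarrow> x \<in> S \<and> (\<forall>z. x + z \<in> S \<longrightarrow> x - z \<in> S \<longrightarrow> z = 0)"
proof (intro iffI conjI allI impI)
  assume "x extreme_point_of S"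
  then show "x \<in> S" by (simp add: extreme_point_of_def)
next
  fix z assume "x extreme_point_of S" "x + z \<in> S" "x - z \<in> S"
  then show "z = 0" using mid_in_open_segment[of z x] by (auto simp: extreme_point_of_def)
next
  assume *: "x \<in> S \<and> (\<forall>z. x + z \<in> S \<longrightarrow> x - z \<in> S \<longrightarrow> z = 0)"
  show "x extreme_point_of S"
    unfolding extreme_point_of_def
  proof (intro conjI ballI notI)
    fix a b assume "a \<in> S" "b \<in> S" and x: "x \<in> open_segment a b"
    then have sub: "closed_segment a b \<subseteq> S" using assms by (simp add: closed_segment_subset)
    from x obtain e where "e > 0" "x + e *\<^sub>R (b - a) \<in> S" "x - e *\<^sub>R (b - a) \<in> S"
      using open_segment_symmetric_bounds[OF x] sub by (metis subsetD)
    then have "e *\<^sub>R (b - a) = 0" using * by blast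
    then show False using \<open>e > 0\<close> x by auto
  qed (use * in auto)
qed

text \<open>Active inequalities survive by the sign condition; inactive ones have slack and survive
  a short step by continuity, uniformly because \<open>S\<close> is finite.\<close>

lemma hpoly_small_step:
  assumes "finite S" "x \<in> hpoly S" "\<And>h. h \<in> active S x \<Longrightarrow> fst h \<bullet> z \<le> 0"
  obtains e where "e > 0" "\<And>t. 0 \<le> t \<Longrightarrow> t \<le> e \<Longrightarrow> x + t *\<^sub>R z \<in> hpoly S"
proof -
  have "\<exists>e>0. \<forall>h\<in>S. fst h \<bullet> (x + e *\<^sub>R z) \<le> snd h"
  proof -
    have "eventually (\<lambda>e. fst h \<bullet> (x + e *\<^sub>R z) \<le> snd h) (at_right 0)" if h: "h \<in> S" for h
    proof (cases "h \<in> active S x")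
      case True
      have "fst h \<bullet> (x + e *\<^sub>R z) \<le> snd h" if "0 < e" for e
        using assms(3)[OF True] True that
        by (auto simp: active_def inner_add_right mult_nonneg_nonpos)
      then show ?thesis by (auto simp: eventually_at_right_less eventually_at_filter)
    next
      case False
      then have "fst h \<bullet> x < snd h" using h assms(2) by (force simp: active_def hpoly_def)
      moreover have "((\<lambda>e. fst h \<bullet> (x + e *\<^sub>R z)) \<longlongrightarrow> fst h \<bullet> (x + 0 *\<^sub>R z)) (at_right 0)"
        by (intro tendsto_intros)
      ultimately have "eventually (\<lambda>e. fst h \<bullet> (x + e *\<^sub>R z) < snd h) (at_right 0)"
        by (intro order_tendstoD) auto
      then show ?thesis by (rule eventually_mono) auto
    qed
    then have "eventually (\<lambda>e. \<forall>h\<in>S. fst h \<bullet> (x + e *\<^sub>R z) \<le> snd h) (at_right 0)"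
      using assms(1) by (simp add: eventually_ball_finite)
    moreover have "eventually (\<lambda>e::real. e > 0) (at_right 0)" by (simp add: eventually_at_right_less)
    ultimately have "eventually (\<lambda>e. e > 0 \<and> (\<forall>h\<in>S. fst h \<bullet> (x + e *\<^sub>R z) \<le> snd h)) (at_right 0)"
      by (simp add: eventually_conj_iff)
    then show ?thesis using eventually_happens[of _ "at_right (0::real)"] by (auto simp: trivial_limit_at_right_real)
  qed
  then obtain e where "e > 0" "x + e *\<^sub>R z \<in> hpoly S" by (auto simp: hpoly_def)
  then show ?thesis using that[of e] convex_mem_between[OF convex_hpoly assms(2)] by blast
qed

lemma hpoly_small_step2:
  assumes "finite S" "x \<in> hpoly S" "z \<in> annih (active S x)"
  obtains e where "e > 0" "x + e *\<^sub>R z \<in> hpoly S" "x - e *\<^sub>R z \<in> hpoly S"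
proof -
  obtain e where e: "e > 0" "\<And>t. 0 \<le> t \<Longrightarrow> t \<le> e \<Longrightarrow> x + t *\<^sub>R z \<in> hpoly S"
    using hpoly_small_step[OF assms(1,2), of z] assms(3) by (auto simp: annih_def)
  obtain f where f: "f > 0" "\<And>t. 0 \<le> t \<Longrightarrow> t \<le> f \<Longrightarrow> x + t *\<^sub>R (-z) \<in> hpoly S"
    using hpoly_small_step[OF assms(1,2), of "-z"] assms(3) by (auto simp: annih_def)
  show ?thesis using that[of "min e f"] e(1) f(1) e(2)[of "min e f"] f(2)[of "min e f"] by auto
qed

lemma mid_in_annih:
  assumes "x + z \<in> hpoly S" "x - z \<in> hpoly S" "h \<in> active S x"
  shows "fst h \<bullet> z = 0"
proof -
  have "h \<in> S" "fst h \<bullet> x = snd h" using assms(3) by (auto simp: active_def)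
  then have "fst h \<bullet> (x + z) \<le> fst h \<bullet> x" "fst h \<bullet> (x - z) \<le> fst h \<bullet> x"
    using assms by (auto simp: hpoly_def)
  then show ?thesis by (simp add: inner_add_right inner_diff_right)
qed

text \<open>Up to scaling, the symmetric feasible perturbations at a point are the vectors
  orthogonal to all active normals.\<close>

lemma vertex_iff:
  assumes "finite S"
  shows "x \<in> poly_vertices (hpoly S) \<longleftrightarrow> x \<in> hpoly S \<and> annih (active S x) \<subseteq> {0}"
proof (intro iffI conjI)
  assume "x \<in> poly_vertices (hpoly S)"
  then have ext: "x extreme_point_of hpoly S" by (simp add: poly_vertices_def)
  then show x: "x \<in> hpoly S" by (simp add: extreme_point_of_def)
  show "annih (active S x) \<subseteq> {0}"
  proof
    fix z assume z: "z \<in> annih (active S x)"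
    obtain e where "e > 0" "x + e *\<^sub>R z \<in> hpoly S" "x - e *\<^sub>R z \<in> hpoly S"
      using hpoly_small_step2[OF assms x z] .
    then have "e *\<^sub>R z = 0" using ext unfolding extreme_iff_mid[OF convex_hpoly] by blast
    then show "z \<in> {0}" using \<open>e > 0\<close> by simp
  qed
next
  assume *: "x \<in> hpoly S \<and> annih (active S x) \<subseteq> {0}"
  have "z = 0" if "x + z \<in> hpoly S" "x - z \<in> hpoly S" for z
  proof -
    have "z \<in> annih (active S x)" unfolding annih_def using mid_in_annih[OF that] by blast
    then show ?thesis using * by blast
  qed
  then show "x \<in> poly_vertices (hpoly S)"
    using * by (auto simp: poly_vertices_def extreme_iff_mid[OF convex_hpoly])
qed

text \<open>Two nonnegative slacks average to zero only if both vanish.\<close>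

lemma active_mid:
  assumes "x \<in> hpoly S" "y \<in> hpoly S"
  shows "active S (midpoint x y) = active S x \<inter> active S y"
proof -
  have "fst h \<bullet> midpoint x y = snd h \<longleftrightarrow> fst h \<bullet> x = snd h \<and> fst h \<bullet> y = snd h" if "h \<in> S" for h
    using hpolyD[OF assms(1) that] hpolyD[OF assms(2) that]
    by (auto simp: midpoint_def inner_add_right)
  then show ?thesis by (auto simp: active_def)
qed

text \<open>A point of \<open>P\<close> beyond one end would place that end inside an open segment
  of \<open>P\<close>. This pins down the ends of edges in later arguments.\<close>

lemma mem_line_between_extreme:
  fixes x y :: "'a::euclidean_space"
  assumes "x extreme_point_of P" "y extreme_point_of P" "x \<noteq> y" "x + s *\<^sub>R (y - x) \<in> P"
  shows "0 \<le> s \<and> s \<le> 1"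
proof (rule conjI; rule ccontr)
  let ?p = "x + s *\<^sub>R (y - x)"
  have P: "x \<in> P" "y \<in> P" using assms by (auto simp: extreme_point_of_def)
  assume "\<not> 0 \<le> s"
  then have s: "s < 0" by simp
  have "y - ?p = (1 - s) *\<^sub>R (y - x)" by (simp add: algebra_simps)
  then have "((-s) / (1 - s)) *\<^sub>R (y - ?p) = (-s) *\<^sub>R (y - x)" using s by simp
  moreover have "(1 - (-s) / (1 - s)) *\<^sub>R ?p + ((-s) / (1 - s)) *\<^sub>R y = ?p + ((-s) / (1 - s)) *\<^sub>R (y - ?p)"
    by (simp only: scaleR_left_diff_distrib scaleR_right_diff_distrib) simp
  ultimately have "x = (1 - (-s) / (1 - s)) *\<^sub>R ?p + ((-s) / (1 - s)) *\<^sub>R y" by simp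
  moreover have "?p \<noteq> y"
  proof
    assume "?p = y"
    then have "(1 - s) *\<^sub>R (x - y) = 0" by (simp add: algebra_simps)
    then show False using s assms(3) by simp
  qed
  ultimately have "x \<in> open_segment ?p y"
    using s unfolding in_segment by (intro conjI exI[of _ "(-s)/(1-s)"]) (auto simp: field_simps)
  then show False using assms P by (auto simp: extreme_point_of_def)
next
  let ?p = "x + s *\<^sub>R (y - x)"
  have P: "x \<in> P" "y \<in> P" using assms by (auto simp: extreme_point_of_def)
  assume "\<not> s \<le> 1"
  then have s: "s > 1" by simp
  have "y = (1 - 1/s) *\<^sub>R x + (1/s) *\<^sub>R ?p" using s by (simp add: algebra_simps)
  moreover have "?p \<noteq> x" using s assms(3) by simp
  ultimately have "y \<in> open_segment x ?p"
    using s unfolding in_segment by (intro conjI exI[of _ "1/s"]) auto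
  then show False using assms P by (auto simp: extreme_point_of_def)
qed

lemma segment_mid_span:
  fixes x y z :: "'a::euclidean_space"
  assumes "midpoint x y + z \<in> closed_segment x y"
  shows "z \<in> span {y - x}"
proof -
  obtain u where u: "midpoint x y + z = (1 - u) *\<^sub>R x + u *\<^sub>R y" using assms by (auto simp: in_segment)
  define k where "k = u - 1/2"
  have u': "u = 1/2 + k" by (simp add: k_def)
  have "z = (1 - u) *\<^sub>R x + u *\<^sub>R y - midpoint x y" using u by (simp add: algebra_simps)
  also have "\<dots> = k *\<^sub>R (y - x)"
    unfolding midpoint_def u' by (simp add: scaleR_add_left scaleR_diff_left scaleR_add_right scaleR_diff_right)
  finally show ?thesis by (simp add: span_base span_mul)
qed

text \<open>The midpoint represents the whole segment: a symmetric perturbation at any other point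
  of it yields one at the midpoint by convexity. Perturbations along the line are then confined to
  the segment because both ends are extreme.\<close>

lemma adj_iff_mid:
  fixes P :: "'a::euclidean_space set"
  assumes "convex P"
  shows "poly_adj P x y \<longleftrightarrow> x \<in> poly_vertices P \<and> y \<in> poly_vertices P \<and> x \<noteq> y \<and>
    (\<forall>z. midpoint x y + z \<in> P \<longrightarrow> midpoint x y - z \<in> P \<longrightarrow> z \<in> span {y - x})"
proof (intro iffI conjI allI impI)
  assume adj: "poly_adj P x y"
  then show "x \<in> poly_vertices P" "y \<in> poly_vertices P" and xy: "x \<noteq> y" by (auto simp: poly_adj_def)
  fix z assume z: "midpoint x y + z \<in> P" "midpoint x y - z \<in> P"
  show "z \<in> span {y - x}"
  proof (cases "z = 0")
    case False
    have "closed_segment x y face_of P" using adj by (simp add: poly_adj_def edge_of_def)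
    then have "midpoint x y + z \<in> closed_segment x y"
      using face_ofD[OF _ mid_in_open_segment[OF False, of "midpoint x y"]] z by auto
    then show ?thesis by (rule segment_mid_span)
  qed (simp add: span_zero)
next
  assume *: "x \<in> poly_vertices P \<and> y \<in> poly_vertices P \<and> x \<noteq> y \<and>
    (\<forall>z. midpoint x y + z \<in> P \<longrightarrow> midpoint x y - z \<in> P \<longrightarrow> z \<in> span {y - x})"
  then have ext: "x extreme_point_of P" "y extreme_point_of P" and xy: "x \<noteq> y" by (auto simp: poly_vertices_def)
  then have P: "x \<in> P" "y \<in> P" by (auto simp: extreme_point_of_def)
  have key: "p \<in> closed_segment x y \<and> q \<in> closed_segment x y"
    if pq: "p \<in> P" "q \<in> P" "w \<in> open_segment p q" "w \<in> closed_segment x y" for p q w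
  proof -
    obtain e where e: "e > 0" "w + e *\<^sub>R (q - p) \<in> P" "w - e *\<^sub>R (q - p) \<in> P"
      using open_segment_symmetric_bounds[OF pq(3)] closed_segment_subset[OF pq(1,2) assms] by (metis subsetD)
    obtain u where u: "0 \<le> u" "u \<le> 1" "w = (1 - u) *\<^sub>R x + u *\<^sub>R y" using pq(4) by (auto simp: in_segment)
    \<comment> \<open>The mirror image of \<open>w\<close> in the midpoint. Averaging a perturbation
      of \<open>w\<close> with the fixed point \<open>w'\<close> gives a perturbation of the
      midpoint of half the size.\<close>
    define w' where "w' = u *\<^sub>R x + (1 - u) *\<^sub>R y"
    have w': "w' \<in> P" unfolding w'_def using P u assms by (intro convexD) auto
    have "midpoint x y = midpoint w w'" by (simp add: midpoint_def u w'_def algebra_simps)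
    then have m: "midpoint x y + (e/2) *\<^sub>R (q - p) = (1/2) *\<^sub>R (w + e *\<^sub>R (q - p)) + (1/2) *\<^sub>R w'"
       "midpoint x y - (e/2) *\<^sub>R (q - p) = (1/2) *\<^sub>R (w - e *\<^sub>R (q - p)) + (1/2) *\<^sub>R w'"
      by (simp_all add: midpoint_def algebra_simps)
    have "midpoint x y + (e/2) *\<^sub>R (q - p) \<in> P" "midpoint x y - (e/2) *\<^sub>R (q - p) \<in> P"
      unfolding m using e w' assms by (intro convexD; simp)+
    then have "(e/2) *\<^sub>R (q - p) \<in> span {y - x}" using * by blast
    then have "(2/e) *\<^sub>R ((e/2) *\<^sub>R (q - p)) \<in> span {y - x}" by (rule span_mul)
    then have "q - p \<in> span {y - x}" using e(1) by simp
    then obtain k where k: "q - p = k *\<^sub>R (y - x)" by (auto simp: span_singleton)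
    obtain v where v: "w = (1 - v) *\<^sub>R p + v *\<^sub>R q" using pq(3) by (auto simp: in_segment)
    then have "p = w - v *\<^sub>R (q - p)" "q = w + (1 - v) *\<^sub>R (q - p)" by (auto simp: algebra_simps)
    then have "p = x + (u - v * k) *\<^sub>R (y - x)" "q = x + (u + (1 - v) * k) *\<^sub>R (y - x)"
      unfolding k u(3) by (auto simp: algebra_simps)
    then obtain s t where st: "p = x + s *\<^sub>R (y - x)" "q = x + t *\<^sub>R (y - x)" by blast
    then have "0 \<le> s \<and> s \<le> 1" "0 \<le> t \<and> t \<le> 1"
      using mem_line_between_extreme[OF ext xy] pq(1,2) by auto
    moreover have "p = (1 - s) *\<^sub>R x + s *\<^sub>R y" "q = (1 - t) *\<^sub>R x + t *\<^sub>R y"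
      using st by (auto simp: algebra_simps)
    ultimately show ?thesis by (auto simp: in_segment)
  qed
  have "closed_segment x y face_of P"
    unfolding face_of_def using closed_segment_subset[OF P assms] key by auto
  then show "poly_adj P x y"
    using * xy by (simp add: poly_adj_def edge_of_def segment_convex_hull aff_dim_convex_hull aff_dim_2)
qed

lemma adj_iff:
  assumes "finite S"
  shows "poly_adj (hpoly S) x y \<longleftrightarrow>
    x \<in> poly_vertices (hpoly S) \<and> y \<in> poly_vertices (hpoly S) \<and> x \<noteq> y \<and>
    annih (active S x \<inter> active S y) \<subseteq> span {y - x}" (is "?L \<longleftrightarrow> ?R")
proof -
  have "(\<forall>z. midpoint x y + z \<in> hpoly S \<longrightarrow> midpoint x y - z \<in> hpoly S \<longrightarrow> z \<in> span {y - x}) \<longleftrightarrow>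
    annih (active S x \<inter> active S y) \<subseteq> span {y - x}" (is "?M \<longleftrightarrow> ?K")
    if "x \<in> poly_vertices (hpoly S)" "y \<in> poly_vertices (hpoly S)"
  proof -
    have P: "x \<in> hpoly S" "y \<in> hpoly S" using that by (auto simp: poly_vertices_def extreme_point_of_def)
    have mid: "midpoint x y \<in> hpoly S"
      using convexD[OF convex_hpoly P, of "1/2" "1/2"] by (simp add: midpoint_def scaleR_right_distrib)
    show ?thesis
    proof
      assume M: ?M
      show ?K
      proof
        fix z assume "z \<in> annih (active S x \<inter> active S y)"
        then have "z \<in> annih (active S (midpoint x y))" by (simp add: active_mid[OF P])
        then obtain e where e: "e > 0" "midpoint x y + e *\<^sub>R z \<in> hpoly S" "midpoint x y - e *\<^sub>R z \<in> hpoly S"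
          using hpoly_small_step2[OF assms mid] by metis
        then have "e *\<^sub>R z \<in> span {y - x}" using M by blast
        then have "(1/e) *\<^sub>R (e *\<^sub>R z) \<in> span {y - x}" by (rule span_mul)
        then show "z \<in> span {y - x}" using e(1) by simp
      qed
    next
      assume K: ?K
      show ?M
        using mid_in_annih[where S = S and x = "midpoint x y"] K
        by (auto simp: active_mid[OF P] annih_def)
    qed
  qed
  then show ?thesis unfolding adj_iff_mid[OF convex_hpoly] by blast
qed

lemma poly_adj_sym: "poly_adj P x y \<Longrightarrow> poly_adj P y x"
  by (auto simp: poly_adj_def closed_segment_commute)

section \<open>Edge directions and the simplex method\<close>

text \<open>Extreme rays of the cone of feasible directions at \<open>x\<close>. Unlike
  \<open>poly_adj\<close> this also covers unbounded edges, along which no second vertex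
  exists.\<close>

definition edge_dir :: "('a::euclidean_space \<times> real) set \<Rightarrow> 'a \<Rightarrow> 'a \<Rightarrow> bool" where
  "edge_dir S x r \<longleftrightarrow> r \<noteq> 0 \<and> (\<forall>h\<in>active S x. fst h \<bullet> r \<le> 0) \<and>
     annih {h \<in> active S x. fst h \<bullet> r = 0} \<subseteq> span {r}"

lemma vertex_in: "x \<in> poly_vertices P \<Longrightarrow> x \<in> P"
  by (simp add: poly_vertices_def extreme_point_of_def)

lemma last_point_on_ray:
  fixes x r :: "'a::euclidean_space"
  assumes "x \<in> hpoly S" "\<not> (\<forall>t\<ge>0. x + t *\<^sub>R r \<in> hpoly S)"
  obtains t where "t \<ge> 0" "x + t *\<^sub>R r \<in> hpoly S" "\<And>s. s > t \<Longrightarrow> x + s *\<^sub>R r \<notin> hpoly S"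
proof -
  obtain t1 where t1: "t1 \<ge> 0" "x + t1 *\<^sub>R r \<notin> hpoly S" using assms by blast
  define T where "T = {t. 0 \<le> t \<and> x + t *\<^sub>R r \<in> hpoly S}"
  have bd: "t \<le> t1" if "t \<in> T" for t
    using convex_mem_between[OF convex_hpoly assms(1), of t r t1] that t1 by (force simp: T_def)
  have "T = {0..} \<inter> (\<lambda>t. x + t *\<^sub>R r) -` hpoly S" by (auto simp: T_def)
  moreover have "closed ((\<lambda>t. x + t *\<^sub>R r) -` hpoly S)"
    by (intro closed_vimage closed_hpoly continuous_intros)
  ultimately have "closed T" by (simp add: closed_Int)
  have "0 \<in> T" using assms(1) by (simp add: T_def)
  then have ne: "T \<noteq> {}" by blast
  have ba: "bdd_above T" using bd by (rule bdd_aboveI)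
  have "Sup T \<in> T" using closed_contains_Sup[OF ne ba \<open>closed T\<close>] .
  moreover have "x + s *\<^sub>R r \<notin> hpoly S" if "s > Sup T" for s
  proof
    assume "x + s *\<^sub>R r \<in> hpoly S"
    moreover have "s \<ge> 0" using that \<open>Sup T \<in> T\<close> by (auto simp: T_def)
    ultimately have "s \<in> T" by (auto simp: T_def)
    then show False using cSup_upper[OF _ ba] that by fastforce
  qed
  moreover have "t \<ge> 0 \<and> x + t *\<^sub>R r \<in> hpoly S" if "t \<in> T" for t using that by (auto simp: T_def)
  ultimately show ?thesis using that[of "Sup T"] by blast
qed

text \<open>At the last feasible point some new inequality blocks the direction \<open>r\<close>. It
  is not constant along \<open>r\<close>, so it cuts the kernel from the line spanned by
  \<open>r\<close> down to zero and makes the end point a vertex.\<close>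

lemma edge_ends:
  assumes "finite S" "x \<in> poly_vertices (hpoly S)" "edge_dir S x r" "\<not> (\<forall>t\<ge>0. x + t *\<^sub>R r \<in> hpoly S)"
  obtains t where "t > 0" "poly_adj (hpoly S) x (x + t *\<^sub>R r)" "\<And>s. s > t \<Longrightarrow> x + s *\<^sub>R r \<notin> hpoly S"
proof -
  have x: "x \<in> hpoly S" using vertex_in assms(2) by blast
  obtain t where t: "t \<ge> 0" "x + t *\<^sub>R r \<in> hpoly S" "\<And>s. s > t \<Longrightarrow> x + s *\<^sub>R r \<notin> hpoly S"
    using last_point_on_ray[OF x assms(4)] by blast
  obtain e where e: "e > 0" "\<And>t. 0 \<le> t \<Longrightarrow> t \<le> e \<Longrightarrow> x + t *\<^sub>R r \<in> hpoly S"
    using hpoly_small_step[OF assms(1) x, of r] assms(3) by (auto simp: edge_dir_def)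
  have "t > 0" using t(3)[of e] e(2)[of e] e(1) t(1) by (metis linorder_not_le order_less_le)
  let ?y = "x + t *\<^sub>R r"
  let ?A = "{h \<in> active S x. fst h \<bullet> r = 0}"
  have A: "?A \<subseteq> active S x \<inter> active S ?y" by (auto simp: active_def inner_add_right)
  have r: "r \<noteq> 0" "annih ?A \<subseteq> span {r}" using assms(3) by (auto simp: edge_dir_def)
  obtain h where h: "h \<in> active S ?y" "fst h \<bullet> r > 0"
  proof (rule ccontr)
    assume "\<not> thesis"
    then have *: "\<And>h. h \<in> active S ?y \<Longrightarrow> fst h \<bullet> r \<le> 0" using that by fastforce
    obtain e where "e > 0" "\<And>t'. 0 \<le> t' \<Longrightarrow> t' \<le> e \<Longrightarrow> ?y + t' *\<^sub>R r \<in> hpoly S"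
      using hpoly_small_step[OF assms(1) t(2) *] by blast
    then have "x + (t + e) *\<^sub>R r \<in> hpoly S" by (simp add: scaleR_add_left add.assoc)
    then show False using t(3)[of "t + e"] \<open>e > 0\<close> by auto
  qed
  have "annih (active S ?y) \<subseteq> {0}"
  proof
    fix z assume z: "z \<in> annih (active S ?y)"
    then have "z \<in> span {r}" using annih_antimono[of ?A "active S ?y"] A r(2) by blast
    then obtain k where k: "z = k *\<^sub>R r" by (auto simp: span_singleton)
    have "fst h \<bullet> z = 0" using z h by (auto simp: annih_def)
    then show "z \<in> {0}" using h(2) k by simp
  qed
  then have "?y \<in> poly_vertices (hpoly S)" using vertex_iff[OF assms(1)] t(2) by blast
  moreover have "annih (active S x \<inter> active S ?y) \<subseteq> span {?y - x}"
  proof -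
    have "span {?y - x} = span {r}" using \<open>t > 0\<close> span_image_scale[of "{r}" "\<lambda>_. t"] by simp
    then show ?thesis using annih_antimono[OF A] r(2) by blast
  qed
  ultimately have "poly_adj (hpoly S) x ?y"
    unfolding adj_iff[OF assms(1)] using assms(2) r(1) \<open>t > 0\<close> by simp
  then show ?thesis using that \<open>t > 0\<close> t(3) by blast
qed

lemma adj_edge_dir:
  assumes "finite S" "poly_adj (hpoly S) x y"
  shows "edge_dir S x (y - x)"
proof -
  have adj: "x \<in> poly_vertices (hpoly S)" "y \<in> poly_vertices (hpoly S)" "x \<noteq> y"
    "annih (active S x \<inter> active S y) \<subseteq> span {y - x}"
    using assms by (auto simp: adj_iff)
  have "fst h \<bullet> (y - x) \<le> 0" if "h \<in> active S x" for h
    using hpolyD[OF vertex_in[OF adj(2)], of h] that by (auto simp: active_def inner_diff_right)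
  moreover have "{h \<in> active S x. fst h \<bullet> (y - x) = 0} = active S x \<inter> active S y"
    by (auto simp: active_def inner_diff_right)
  ultimately show ?thesis using adj by (simp add: edge_dir_def)
qed

text \<open>On the cone the sum of all normals is a sum of nonpositive terms; it vanishes only where
  each term does, hence only at 0. Compactness of the unit vectors of the cone turns strict
  negativity into a uniform rate \<open>\<kappa>\<close>.\<close>

lemma cone_exposed:
  fixes H :: "('a::euclidean_space \<times> real) set"
  assumes "finite H" "annih H \<subseteq> {0}"
  obtains g \<kappa> where "\<kappa> > 0" "\<And>z. (\<And>h. h \<in> H \<Longrightarrow> fst h \<bullet> z \<le> 0) \<Longrightarrow> g \<bullet> z \<le> - \<kappa> * norm z"
proof -
  define g where "g = (\<Sum>h\<in>H. fst h)"
  define C where "C = {z. norm z = 1} \<inter> (\<Inter>h\<in>H. {z. fst h \<bullet> z \<le> 0})"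
  have g: "g \<bullet> z = (\<Sum>h\<in>H. fst h \<bullet> z)" for z by (simp add: g_def inner_sum_left)
  have "compact C"
  proof -
    have "{z::'a. norm z = 1} = sphere 0 1" by (auto simp: sphere_def dist_norm)
    then show ?thesis unfolding C_def
      by (intro compact_Int_closed) (auto simp: closed_halfspace_le)
  qed
  have neg: "g \<bullet> z < 0" if "z \<in> C" for z
  proof -
    have le: "\<And>h. h \<in> H \<Longrightarrow> fst h \<bullet> z \<le> 0" using that by (auto simp: C_def)
    then have "g \<bullet> z \<le> 0" by (simp add: g sum_nonpos)
    moreover have "g \<bullet> z \<noteq> 0"
    proof
      assume "g \<bullet> z = 0"
      then have "(\<Sum>h\<in>H. - (fst h \<bullet> z)) = 0" by (simp add: g sum_negf)
      then have "\<forall>h\<in>H. - (fst h \<bullet> z) = 0" using assms(1) le by (subst (asm) sum_nonneg_eq_0_iff) auto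
      then have "z \<in> annih H" by (simp add: annih_def)
      then show False using assms(2) that by (auto simp: C_def)
    qed
    ultimately show ?thesis by simp
  qed
  have "\<exists>\<kappa>>0. \<forall>z\<in>C. g \<bullet> z \<le> - \<kappa>"
  proof (cases "C = {}")
    case False
    then obtain m where m: "m \<in> C" "\<And>z. z \<in> C \<Longrightarrow> g \<bullet> z \<le> g \<bullet> m"
      using continuous_attains_sup[OF \<open>compact C\<close> False, of "\<lambda>z. g \<bullet> z"]
        continuous_on_inner[OF continuous_on_const continuous_on_id, of C g] by blast
    then show ?thesis using neg[OF m(1)] by (intro exI[of _ "- (g \<bullet> m)"]) auto
  qed (auto intro: exI[of _ 1])
  then obtain \<kappa> where \<kappa>: "\<kappa> > 0" "\<And>z. z \<in> C \<Longrightarrow> g \<bullet> z \<le> - \<kappa>" by auto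
  have "g \<bullet> z \<le> - \<kappa> * norm z" if "\<And>h. h \<in> H \<Longrightarrow> fst h \<bullet> z \<le> 0" for z
  proof (cases "z = 0")
    case False
    have "inverse (norm z) *\<^sub>R z \<in> C"
      unfolding C_def using that False by (auto simp: mult_le_0_iff)
    from \<kappa>(2)[OF this] show ?thesis using False by (simp add: field_simps)
  qed simp
  then show ?thesis using that \<kappa>(1) by blast
qed

lemma active_diff_le:
  assumes "z \<in> hpoly S" "h \<in> active S x"
  shows "fst h \<bullet> (z - x) \<le> 0"
  using assms by (auto simp: active_def hpoly_def inner_diff_right)

lemma vertex_exposed:
  assumes "finite S" "x \<in> poly_vertices (hpoly S)"
  obtains g \<kappa> where "\<kappa> > 0" "\<And>z. (\<And>h. h \<in> active S x \<Longrightarrow> fst h \<bullet> z \<le> 0) \<Longrightarrow> g \<bullet> z \<le> - \<kappa> * norm z"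
    "\<And>z. z \<in> hpoly S \<Longrightarrow> g \<bullet> z \<le> g \<bullet> x - \<kappa> * norm (z - x)"
proof -
  have "annih (active S x) \<subseteq> {0}" using assms vertex_iff by blast
  then obtain g \<kappa> where *: "\<kappa> > 0" "\<And>z. (\<And>h. h \<in> active S x \<Longrightarrow> fst h \<bullet> z \<le> 0) \<Longrightarrow> g \<bullet> z \<le> - \<kappa> * norm z"
    using cone_exposed[OF finite_active[OF assms(1)], of x] by metis
  have "g \<bullet> z \<le> g \<bullet> x - \<kappa> * norm (z - x)" if "z \<in> hpoly S" for z
    using *(2)[of "z - x"] active_diff_le[OF that] by (simp add: inner_diff_right)
  then show ?thesis using that * by blast
qed

text \<open>The cross-section of the cone of feasible directions is a polytope whose extreme points span the edges.\<close>

lemma improving_edge_dir: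
  fixes x :: "'a::euclidean_space"
  assumes "finite S" "x \<in> poly_vertices (hpoly S)" "q \<in> hpoly S" "c \<bullet> q > c \<bullet> x"
  obtains r where "edge_dir S x r" "c \<bullet> r > 0"
proof -
  obtain g \<kappa> where g: "\<kappa> > 0" "\<And>z. (\<And>h. h \<in> active S x \<Longrightarrow> fst h \<bullet> z \<le> 0) \<Longrightarrow> g \<bullet> z \<le> - \<kappa> * norm z"
    using vertex_exposed[OF assms(1,2)] by metis
  \<comment> \<open>The cross-section \<open>g \<bullet> z = -1\<close> of the cone, written as two
    opposite inequalities. It is bounded because \<open>g\<close> decreases at rate
    \<open>\<kappa>\<close> on the cone.\<close>
  define T where "T = (\<lambda>h. (fst h, 0::real)) ` active S x \<union> {(g, -1), (- g, 1)}"
  have fT: "finite T" using assms(1) by (simp add: T_def finite_active)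
  have T: "z \<in> hpoly T \<longleftrightarrow> (\<forall>h\<in>active S x. fst h \<bullet> z \<le> 0) \<and> g \<bullet> z = -1" for z
    by (auto simp: T_def hpoly_def)
  have "bounded (hpoly T)"
  proof (rule boundedI)
    fix z assume "z \<in> hpoly T"
    then have "-1 \<le> - \<kappa> * norm z" using g(2)[of z] unfolding T by auto
    then show "norm z \<le> 1 / \<kappa>" using g(1) by (simp add: field_simps)
  qed
  then have KM: "hpoly T = convex hull {r. r extreme_point_of hpoly T}"
    by (intro Krein_Milman_Minkowski) (auto simp: compact_eq_bounded_closed closed_hpoly convex_hpoly)
  have q: "\<And>h. h \<in> active S x \<Longrightarrow> fst h \<bullet> (q - x) \<le> 0" using active_diff_le[OF assms(3)] by blast
  have "q \<noteq> x" using assms(4) by auto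
  then have gq: "g \<bullet> (q - x) < 0" using g(2)[OF q] g(1)
    by (smt (verit) mult_pos_pos mult_minus_left right_minus_eq zero_less_norm_iff)
  define q' where "q' = (- 1 / (g \<bullet> (q - x))) *\<^sub>R (q - x)"
  have q': "q' \<in> hpoly T" unfolding T q'_def using q gq by (auto simp: divide_nonpos_neg)
  have cq': "c \<bullet> q' > 0" unfolding q'_def using gq assms(4) by (simp add: inner_diff_right divide_pos_neg)
  obtain r where r: "r extreme_point_of hpoly T" "c \<bullet> r > 0"
  proof (rule ccontr)
    assume "\<not> thesis"
    then have "{r. r extreme_point_of hpoly T} \<subseteq> {z. c \<bullet> z \<le> 0}" using that by fastforce
    then have "convex hull {r. r extreme_point_of hpoly T} \<subseteq> {z. c \<bullet> z \<le> 0}"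
      by (rule hull_minimal) (simp add: convex_halfspace_le)
    then show False using KM q' cq' by auto
  qed
  have rT: "r \<in> hpoly T" and ker: "annih (active T r) \<subseteq> {0}"
    using r(1) vertex_iff[OF fT, of r] by (auto simp: poly_vertices_def)
  have "annih {h \<in> active S x. fst h \<bullet> r = 0} \<subseteq> span {r}"
  proof
    fix z assume z: "z \<in> annih {h \<in> active S x. fst h \<bullet> r = 0}"
    \<comment> \<open>Since \<open>g \<bullet> r = -1\<close>, adding this multiple of
      \<open>r\<close> projects \<open>z\<close> along \<open>r\<close> onto the kernel of
      \<open>g\<close>, where the vertex criterion for the cross-section applies.\<close>
    have "z + (g \<bullet> z) *\<^sub>R r \<in> annih (active T r)"
      using z rT[unfolded T] by (auto simp: annih_def active_def T_def inner_add_right)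
    then have "z + (g \<bullet> z) *\<^sub>R r = 0" using ker by blast
    then have "z = (- (g \<bullet> z)) *\<^sub>R r" by (simp add: add_eq_0_iff2)
    then show "z \<in> span {r}" by (metis span_base span_mul singletonI)
  qed
  then have "edge_dir S x r" using rT[unfolded T] by (auto simp: edge_dir_def)
  then show ?thesis using that r(2) by blast
qed

lemma improving_neighbour:
  assumes "finite S" "x \<in> poly_vertices (hpoly S)" "q \<in> hpoly S" "c \<bullet> q > c \<bullet> x"
    and "\<And>z. z \<in> hpoly S \<Longrightarrow> c \<bullet> z \<le> M"
  obtains y where "poly_adj (hpoly S) x y" "c \<bullet> y > c \<bullet> x"
proof -
  obtain r where r: "edge_dir S x r" "c \<bullet> r > 0"
    using improving_edge_dir[OF assms(1-4)] by blast
  have "\<not> (\<forall>t\<ge>0. x + t *\<^sub>R r \<in> hpoly S)"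
  proof
    assume *: "\<forall>t\<ge>0. x + t *\<^sub>R r \<in> hpoly S"
    have "M \<ge> c \<bullet> x" using assms(5) vertex_in[OF assms(2)] by blast
    then have "c \<bullet> (x + ((M - c \<bullet> x + 1) / (c \<bullet> r)) *\<^sub>R r) \<le> M" using * r(2) by (intro assms(5)) auto
    then show False using r(2) by (simp add: inner_add_right)
  qed
  then obtain t where "t > 0" "poly_adj (hpoly S) x (x + t *\<^sub>R r)"
    using edge_ends[OF assms(1,2) r(1)] by metis
  then show ?thesis using that r(2) by (simp add: inner_add_right)
qed

section \<open>Connectivity of the graph and estimates of distances\<close>

lemma finite_vertices: "polyhedron P \<Longrightarrow> finite (poly_vertices P)"
  unfolding poly_vertices_def by (rule finite_polyhedron_extreme_points)

lemma poly_adj_vertices: "poly_adj P x y \<Longrightarrow> x \<in> poly_vertices P \<and> y \<in> poly_vertices P"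
  by (auto simp: poly_adj_def)

text \<open>The simplex method without a pivoting rule: among the finitely many reachable vertices,
  one with the largest value of \<open>c\<close> has no improving neighbour and is therefore optimal
  on the whole polyhedron.\<close>

lemma reach_maximum:
  assumes "finite S" "x \<in> poly_vertices (hpoly S)"
    and "\<And>z. z \<in> hpoly S \<Longrightarrow> c \<bullet> z \<le> M"
  obtains y k where "(poly_adj (hpoly S) ^^ k) x y" "y \<in> poly_vertices (hpoly S)"
    "\<And>z. z \<in> hpoly S \<Longrightarrow> c \<bullet> z \<le> c \<bullet> y"
proof -
  let ?R = "{y \<in> poly_vertices (hpoly S). \<exists>k. (poly_adj (hpoly S) ^^ k) x y}"
  have fin: "finite ?R" using finite_vertices[OF polyhedron_hpoly[OF assms(1)]] by simp
  have "x \<in> ?R" using assms(2) by (auto intro: exI[of _ 0])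
  then obtain y where y: "y \<in> ?R" "Max ((\<bullet>) c ` ?R) = c \<bullet> y"
    using obtains_MAX[OF fin, of "(\<bullet>) c"] by blast
  have y: "y \<in> ?R" "\<And>z. z \<in> ?R \<Longrightarrow> c \<bullet> z \<le> c \<bullet> y"
    using y(1) fin unfolding y(2)[symmetric] by auto
  have "c \<bullet> z \<le> c \<bullet> y" if zS: "z \<in> hpoly S" for z
  proof (rule ccontr)
    assume "\<not> c \<bullet> z \<le> c \<bullet> y"
    then have yz: "c \<bullet> z > c \<bullet> y" and yv: "y \<in> poly_vertices (hpoly S)" using y(1) by auto
    obtain w where w: "poly_adj (hpoly S) y w" "c \<bullet> w > c \<bullet> y"
      using improving_neighbour[OF assms(1) yv zS yz assms(3)] .
    obtain k where "(poly_adj (hpoly S) ^^ k) x y" using y(1) by blast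
    then have "(poly_adj (hpoly S) ^^ Suc k) x w" using w(1) by (rule relpowp_Suc_I)
    then have "w \<in> ?R" using poly_adj_vertices[OF w(1)] by blast
    then show False using y(2) w(2) by fastforce
  qed
  then show ?thesis using that y(1) by blast
qed

text \<open>Walk towards the maximum of a functional whose unique maximiser is
  \<open>y\<close>.\<close>

lemma vertices_connected:
  assumes "finite S" "x \<in> poly_vertices (hpoly S)" "y \<in> poly_vertices (hpoly S)"
  obtains k where "(poly_adj (hpoly S) ^^ k) x y"
proof -
  obtain g \<kappa> where g: "\<kappa> > 0" "\<And>z. z \<in> hpoly S \<Longrightarrow> g \<bullet> z \<le> g \<bullet> y - \<kappa> * norm (z - y)"
    using vertex_exposed[OF assms(1,3)] by metis
  then have "\<And>z. z \<in> hpoly S \<Longrightarrow> g \<bullet> z \<le> g \<bullet> y" by (smt (verit) mult_nonneg_nonneg norm_ge_zero)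
  then obtain w k where w: "(poly_adj (hpoly S) ^^ k) x w" "w \<in> poly_vertices (hpoly S)"
    "\<And>z. z \<in> hpoly S \<Longrightarrow> g \<bullet> z \<le> g \<bullet> w"
    using reach_maximum[OF assms(1,2)] by metis
  have "g \<bullet> y \<le> g \<bullet> w" using w(3) vertex_in[OF assms(3)] by blast
  then have "\<kappa> * norm (w - y) \<le> 0" using g(2)[OF vertex_in[OF w(2)]] by linarith
  then have "w = y" using g(1) by (simp add: mult_le_0_iff)
  then show ?thesis using that w(1) by blast
qed

lemma relpowp_sym:
  assumes "\<And>x y. R x y \<Longrightarrow> R y x" "(R ^^ k) x y"
  shows "(R ^^ k) y x"
  using assms(2)
proof (induction k arbitrary: y)
  case (Suc k)
  then obtain z where "(R ^^ k) x z" "R z y" by auto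
  then show ?case using Suc.IH assms(1) by (metis relpowp_Suc_I2)
qed auto

lemma graph_dist_le: "(poly_adj P ^^ k) x y \<Longrightarrow> graph_dist P x y \<le> enat k"
  unfolding graph_dist_def by (rule INF_lower) auto

lemma graph_dist_geI: "(\<And>k. (poly_adj P ^^ k) x y \<Longrightarrow> n \<le> enat k) \<Longrightarrow> n \<le> graph_dist P x y"
  unfolding graph_dist_def by (rule INF_greatest) auto

lemma graph_dist_attained:
  assumes "(poly_adj P ^^ j) x y"
  obtains k where "(poly_adj P ^^ k) x y" "graph_dist P x y = enat k"
proof -
  define k where "k = (LEAST k. (poly_adj P ^^ k) x y)"
  have "(poly_adj P ^^ k) x y" unfolding k_def using assms by (rule LeastI)
  moreover have "graph_dist P x y = enat k"
    by (rule antisym[OF graph_dist_le[OF calculation] graph_dist_geI]) (auto simp: k_def Least_le)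
  ultimately show ?thesis using that by blast
qed

lemma graph_dist_commute: "graph_dist P x y = graph_dist P y x"
  by (auto intro!: antisym graph_dist_geI graph_dist_le intro: relpowp_sym poly_adj_sym)

lemma graph_dist_le_diameter:
  "x \<in> poly_vertices P \<Longrightarrow> y \<in> poly_vertices P \<Longrightarrow> graph_dist P x y \<le> graph_diameter P"
  unfolding graph_diameter_def by (meson SUP_upper2 SUP_upper)

text \<open>Lower bounds for distances in a modified polyhedron come from a function growing by at
  most one along its edges, so its paths need not be translated back to the original
  polyhedron.\<close>

lemma graph_dist_ge_potential:
  fixes f :: "'a::euclidean_space \<Rightarrow> nat"
  assumes "\<And>p q. poly_adj P p q \<Longrightarrow> f q \<le> Suc (f p)" "f x = 0"
  shows "enat (f y) \<le> graph_dist P x y"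
proof (rule graph_dist_geI)
  fix k assume "(poly_adj P ^^ k) x y"
  then have "f y \<le> k"
  proof (induction k arbitrary: y)
    case (Suc k)
    then obtain z where "(poly_adj P ^^ k) x z" "poly_adj P z y" by auto
    then show ?case using Suc.IH[of z] assms(1)[of z y] by linarith
  qed (use assms(2) in auto)
  then show "enat (f y) \<le> enat k" by simp
qed

section \<open>Irredundant descriptions and facets\<close>

text \<open>The strictly feasible point excludes implicit equations among the inequalities, so that
  \<open>A\<close> is forced to be the affine hull.\<close>

definition full_rep :: "'a::euclidean_space set \<Rightarrow> ('a \<times> real) set \<Rightarrow> 'a set \<Rightarrow> bool" where
  "full_rep A N P \<longleftrightarrow> affine A \<and> finite N \<and> P = A \<inter> hpoly N \<and> (\<exists>x\<in>A. \<forall>h\<in>N. fst h \<bullet> x < snd h)"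

text \<open>Each inequality owns a witness point at which it alone is tight. In this form
  irredundancy survives any further cut that keeps all witnesses strictly feasible.\<close>

definition irredundant :: "'a::euclidean_space set \<Rightarrow> ('a \<times> real) set \<Rightarrow> bool" where
  "irredundant A N \<longleftrightarrow> (\<forall>h\<in>N. \<exists>z\<in>A. fst h \<bullet> z = snd h \<and> (\<forall>k\<in>N - {h}. fst k \<bullet> z < snd k))"

definition facets :: "'a::euclidean_space set \<Rightarrow> 'a set set" where
  "facets P = {F. F facet_of P}"

lemma full_rep_in: "full_rep A N P \<Longrightarrow> x \<in> P \<longleftrightarrow> x \<in> A \<and> (\<forall>h\<in>N. fst h \<bullet> x \<le> snd h)"
  by (auto simp: full_rep_def hpoly_def)

lemma full_repD: "full_rep A N P \<Longrightarrow> affine A" "full_rep A N P \<Longrightarrow> finite N" "full_rep A N P \<Longrightarrow> P = A \<inter> hpoly N"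
  unfolding full_rep_def by blast+

lemma full_rep_convex: "full_rep A N P \<Longrightarrow> convex P"
  unfolding full_rep_def using convex_Int[OF affine_imp_convex convex_hpoly] by blast

lemma open_strict: "finite N \<Longrightarrow> open {x::'a::euclidean_space. \<forall>h\<in>N. fst h \<bullet> x < snd h}"
proof -
  assume "finite N"
  have "{x::'a. \<forall>h\<in>N. fst h \<bullet> x < snd h} = (\<Inter>h\<in>N. {x. fst h \<bullet> x < snd h})" by auto
  then show ?thesis using \<open>finite N\<close> by (simp add: open_INT open_halfspace_lt)
qed

lemma full_rep_polyhedron: "full_rep A N P \<Longrightarrow> polyhedron P"
  unfolding full_rep_def using polyhedron_Int[OF affine_imp_polyhedron polyhedron_hpoly] by blast

lemma full_rep_affine_hull:
  assumes "full_rep A N P"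
  shows "affine hull P = A"
proof -
  let ?U = "{x. \<forall>h\<in>N. fst h \<bullet> x < snd h}"
  have "affine hull (A \<inter> ?U) = A"
  proof -
    have "affine A" "finite N" "A \<inter> ?U \<noteq> {}" using assms by (auto simp: full_rep_def)
    then have "affine hull (A \<inter> ?U) = affine hull A"
      by (intro affine_hull_affine_Int_open open_strict)
    then show ?thesis using \<open>affine A\<close> affine_hull_eq[of A] by metis
  qed
  moreover have "A \<inter> ?U \<subseteq> P" using full_rep_in[OF assms] by (auto simp: less_imp_le)
  ultimately have "A \<subseteq> affine hull P" using hull_mono[of "A \<inter> ?U" P affine] by simp
  moreover have "affine hull P \<subseteq> A" using hull_minimal[of P A affine] assms unfolding full_rep_def by blast
  ultimately show ?thesis by auto
qed

lemma full_rep_aff_dim: "full_rep A N P \<Longrightarrow> aff_dim P = aff_dim A"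
  by (metis aff_dim_affine_hull full_rep_affine_hull)

lemma full_rep_strict_rel_interior:
  assumes "full_rep A N P" "x \<in> A" "\<And>h. h \<in> N \<Longrightarrow> fst h \<bullet> x < snd h"
  shows "x \<in> rel_interior P"
proof -
  let ?U = "{x. \<forall>h\<in>N. fst h \<bullet> x < snd h}"
  have "open ?U" using assms(1) by (intro open_strict) (auto simp: full_rep_def)
  moreover have "?U \<inter> affine hull P \<subseteq> P"
    using full_rep_in[OF assms(1)] by (auto simp: full_rep_affine_hull[OF assms(1)] less_imp_le)
  ultimately show ?thesis using assms(2,3) full_rep_in[OF assms(1), of x]
    unfolding mem_rel_interior by (auto simp: less_imp_le intro!: exI[of _ ?U])
qed

lemma tight_face:
  assumes "full_rep A N P" "h \<in> N"
  shows "P \<inter> {x. fst h \<bullet> x = snd h} face_of P"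
  using full_rep_in[OF assms(1)] assms(2) by (intro face_of_Int_supporting_hyperplane_le full_rep_convex[OF assms(1)]) auto

text \<open>A relative interior point of \<open>C\<close> is not relatively interior to
  \<open>P\<close>, so some inequality is tight there and hence on all of \<open>C\<close>. The
  corresponding face is proper and contains \<open>C\<close>, and the dimensions leave room only for
  equality.\<close>

lemma facet_tight:
  assumes "full_rep A N P" "C facet_of P"
  obtains h where "h \<in> N" "C = P \<inter> {x. fst h \<bullet> x = snd h}"
proof -
  have C: "C face_of P" "C \<noteq> {}" "aff_dim C = aff_dim P - 1" using assms(2) by (auto simp: facet_of_def)
  have "C \<noteq> P" using C(3) by auto
  have "rel_interior C \<noteq> {}" using C by (simp add: face_of_imp_convex rel_interior_eq_empty)
  then obtain z where z: "z \<in> rel_interior C" by blast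
  then have zC: "z \<in> C" using rel_interior_subset by blast
  then have zP: "z \<in> P" using C(1) face_of_imp_subset by blast
  obtain h where h: "h \<in> N" "fst h \<bullet> z = snd h"
  proof (rule ccontr)
    assume "\<not> thesis"
    then have "z \<in> rel_interior P"
      using full_rep_in[OF assms(1)] zP that by (intro full_rep_strict_rel_interior[OF assms(1)]) (auto simp: less_le)
    then show False using face_of_disjoint_rel_interior[OF C(1) \<open>C \<noteq> P\<close>] zC by blast
  qed
  let ?F = "P \<inter> {x. fst h \<bullet> x = snd h}"
  have F: "?F face_of P" using tight_face[OF assms(1) h(1)] .
  have CF: "C \<subseteq> ?F"
    using subset_of_face_of[OF F face_of_imp_subset[OF C(1)]] z zP h(2) by blast
  then have CfF: "C face_of ?F" using face_of_subset[OF C(1)] by auto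
  obtain x0 where "x0 \<in> A" "\<forall>h\<in>N. fst h \<bullet> x0 < snd h" using assms(1) by (auto simp: full_rep_def)
  then have "x0 \<in> P" "x0 \<notin> ?F" using full_rep_in[OF assms(1)] h(1) by (auto simp: less_imp_le)
  then have "?F \<noteq> P" by blast
  then have "aff_dim ?F < aff_dim P" using face_of_aff_dim_lt[OF full_rep_convex[OF assms(1)] F] by blast
  moreover have "aff_dim C < aff_dim ?F" if "C \<noteq> ?F"
    using face_of_aff_dim_lt[OF face_of_imp_convex[OF F] CfF that] .
  ultimately have "C = ?F" using C(3) by linarith
  then show ?thesis using that h(1) by blast
qed

text \<open>Does not ask for irredundancy, so it applies to facets, relaxations and projective
  images, whose systems may be redundant.\<close>

lemma card_facets_le:
  assumes "full_rep A N P"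
  shows "card (facets P) \<le> card N"
proof -
  have "facets P \<subseteq> (\<lambda>h. P \<inter> {x. fst h \<bullet> x = snd h}) ` N"
  proof
    fix C assume "C \<in> facets P"
    then have "C facet_of P" by (simp add: facets_def)
    then show "C \<in> (\<lambda>h. P \<inter> {x. fst h \<bullet> x = snd h}) ` N" by (rule facet_tight[OF assms]) (rule image_eqI)
  qed
  then show ?thesis using assms surj_card_le[of N] by (auto simp: full_rep_def)
qed

lemma irredundantD:
  assumes "irredundant A N" "h \<in> N"
  obtains z where "z \<in> A" "fst h \<bullet> z = snd h" "\<And>k. k \<in> N \<Longrightarrow> k \<noteq> h \<Longrightarrow> fst k \<bullet> z < snd k"
  using assms unfolding irredundant_def by blast

text \<open>The witness of \<open>h\<close> is strictly feasible for the remaining inequalities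
  inside the hyperplane. The facet is thus described by one inequality fewer, which bounds the
  number of its own facets.\<close>

lemma facet_rep:
  assumes "full_rep A N P" "irredundant A N" "h \<in> N"
  defines "B \<equiv> A \<inter> {x. fst h \<bullet> x = snd h}" and "F \<equiv> P \<inter> {x. fst h \<bullet> x = snd h}"
  shows "full_rep B (N - {h}) F" and "F face_of P" and "aff_dim F = aff_dim P - 1" and "F facet_of P"
proof -
  obtain z where z: "z \<in> A" "fst h \<bullet> z = snd h" "\<And>k. k \<in> N \<Longrightarrow> k \<noteq> h \<Longrightarrow> fst k \<bullet> z < snd k"
    using irredundantD[OF assms(2,3)] by blast
  have A: "affine A" using assms(1) by (simp add: full_rep_def)
  have zF: "z \<in> F" unfolding F_def using z full_rep_in[OF assms(1)] by (auto simp: less_imp_le) (metis fst_conv less_imp_le order_refl snd_conv)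
  show fr: "full_rep B (N - {h}) F"
    unfolding full_rep_def
  proof (intro conjI)
    show "affine B" unfolding B_def using A by (intro affine_Int affine_hyperplane)
    show "finite (N - {h})" using assms(1) by (simp add: full_rep_def)
    show "F = B \<inter> hpoly (N - {h})"
      using assms(1,3) by (auto simp: F_def B_def full_rep_def hpoly_def)
    show "\<exists>x\<in>B. \<forall>h\<in>N - {h}. fst h \<bullet> x < snd h" using z by (intro bexI[of _ z]) (auto simp: B_def)
  qed
  show "F face_of P" unfolding F_def using tight_face[OF assms(1,3)] .
  obtain x0 where x0: "x0 \<in> A" "\<forall>h\<in>N. fst h \<bullet> x0 < snd h" using assms(1) by (auto simp: full_rep_def)
  have "z \<in> B" "x0 \<notin> B" using z x0 assms(3) by (auto simp: B_def)
  then have "aff_dim B = aff_dim A - 1"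
    using aff_dim_affine_Int_hyperplane[OF A, of "fst h" "snd h"] x0(1) by (auto simp: B_def split: if_splits)
  then show "aff_dim F = aff_dim P - 1" using full_rep_aff_dim[OF fr] full_rep_aff_dim[OF assms(1)] by simp
  then show "F facet_of P" using \<open>F face_of P\<close> zF by (auto simp: facet_of_def)
qed

text \<open>Distinct inequalities give distinct facets because the witness of one lies on no
  other.\<close>

lemma card_facets_eq:
  assumes "full_rep A N P" "irredundant A N"
  shows "card (facets P) = card N"
proof -
  let ?f = "\<lambda>h. P \<inter> {x. fst h \<bullet> x = snd h}"
  have "facets P = ?f ` N"
  proof (rule set_eqI)
    fix C
    have "C facet_of P \<longleftrightarrow> (\<exists>h\<in>N. C = ?f h)"
      using facet_tight[OF assms(1), of C] facet_rep(4)[OF assms] by metis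
    then show "C \<in> facets P \<longleftrightarrow> C \<in> ?f ` N" by (simp add: facets_def image_iff)
  qed
  moreover have "inj_on ?f N"
  proof (rule inj_onI, rule ccontr)
    fix h k assume *: "h \<in> N" "k \<in> N" "?f h = ?f k" "h \<noteq> k"
    obtain z where z: "z \<in> A" "fst h \<bullet> z = snd h" "\<And>k. k \<in> N \<Longrightarrow> k \<noteq> h \<Longrightarrow> fst k \<bullet> z < snd k"
      using irredundantD[OF assms(2) *(1)] by blast
    have "z \<in> P" unfolding full_rep_in[OF assms(1)] using z by (metis less_imp_le order_refl)
    then have "z \<in> ?f h" using z by blast
    then have "z \<in> ?f k" using *(3) by blast
    then show False using z(3)[OF *(2)] *(4) by auto
  qed
  ultimately show ?thesis by (simp add: card_image)
qed

lemma polyhedron_full_rep: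
  fixes P :: "'a::euclidean_space set"
  assumes "polyhedron P" "P \<noteq> {}"
  obtains N where "full_rep (affine hull P) N P" "irredundant (affine hull P) N"
proof -
  let ?A = "affine hull P"
  obtain \<F> where \<F>: "finite \<F>" "P = ?A \<inter> \<Inter>\<F>"
    "\<forall>h\<in>\<F>. \<exists>a b. a \<noteq> 0 \<and> h = {x. a \<bullet> x \<le> b}" "\<And>F'. F' \<subset> \<F> \<Longrightarrow> P \<subset> ?A \<inter> \<Inter>F'"
    using assms(1) unfolding polyhedron_Int_affine_minimal by meson
  then obtain a b where ab: "\<And>h. h \<in> \<F> \<Longrightarrow> a h \<noteq> 0 \<and> h = {x. a h \<bullet> x \<le> b h}" by metis
  define N where "N = (\<lambda>h. (a h, b h)) ` \<F>"
  have mem: "x \<in> P \<longleftrightarrow> x \<in> ?A \<and> (\<forall>h\<in>\<F>. a h \<bullet> x \<le> b h)" for x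
    using \<F>(2) ab by (smt (verit) IntE IntI InterE InterI mem_Collect_eq)
  have ri: "rel_interior P = {x \<in> P. \<forall>h\<in>\<F>. a h \<bullet> x < b h}"
    using rel_interior_polyhedron_explicit[OF \<F>(1,2) ab \<F>(4)] by blast
  moreover have "rel_interior P \<noteq> {}"
    using assms by (simp add: polyhedron_imp_convex rel_interior_eq_empty)
  ultimately obtain x0 where x0: "x0 \<in> ?A" "\<And>h. h \<in> \<F> \<Longrightarrow> a h \<bullet> x0 < b h"
    using mem by blast
  have "full_rep ?A N P"
    unfolding full_rep_def using \<F>(1) x0 mem by (auto simp: N_def hpoly_def)
  moreover have "irredundant ?A N"
    unfolding irredundant_def
  proof
    fix k assume "k \<in> N"
    then obtain h where h: "h \<in> \<F>" "k = (a h, b h)" by (auto simp: N_def)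
    have "\<F> - {h} \<subset> \<F>" using h(1) by blast
    from \<F>(4)[OF this] obtain y where y: "y \<in> ?A" "y \<in> \<Inter>(\<F> - {h})" "y \<notin> P" by blast
    then have yo: "a j \<bullet> y \<le> b j" if "j \<in> \<F>" "j \<noteq> h" for j using ab[OF that(1)] that by blast
    then have yh: "a h \<bullet> y > b h" using y(1,3) mem by fastforce
    \<comment> \<open>The point \<open>y\<close> violates the inequality of \<open>h\<close> only.
      The segment from the strict point \<open>x0\<close> to \<open>y\<close> crosses the hyperplane
      of \<open>h\<close> at parameter \<open>s\<close>, where every other inequality is still
      strict.\<close>
    define s where "s = (b h - a h \<bullet> x0) / (a h \<bullet> y - a h \<bullet> x0)"
    have s: "0 < s" "s < 1" using x0(2)[OF h(1)] yh by (auto simp: s_def divide_simps)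
    define z where "z = (1 - s) *\<^sub>R x0 + s *\<^sub>R y"
    have "z \<in> ?A" unfolding z_def using y(1) x0(1) affine_affine_hull mem_affine by (metis diff_add_cancel)
    moreover have "a h \<bullet> z = b h"
    proof -
      have "a h \<bullet> z = a h \<bullet> x0 + s * (a h \<bullet> y - a h \<bullet> x0)" by (simp add: z_def inner_add_right algebra_simps)
      then show ?thesis using yh x0(2)[OF h(1)] by (simp add: s_def)
    qed
    moreover have zs: "a j \<bullet> z < b j" if "j \<in> \<F>" "j \<noteq> h" for j
    proof -
      have "(1 - s) * (a j \<bullet> x0) < (1 - s) * b j" using x0(2)[OF that(1)] s by simp
      moreover have "s * (a j \<bullet> y) \<le> s * b j" using yo[OF that] s by simp
      ultimately have "a j \<bullet> z < (1 - s) * b j + s * b j" by (simp add: z_def inner_add_right)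
      then show ?thesis by (simp add: algebra_simps)
    qed
    ultimately show "\<exists>z\<in>?A. fst k \<bullet> z = snd k \<and> (\<forall>j\<in>N - {k}. fst j \<bullet> z < snd j)"
    proof (intro bexI[of _ z] conjI ballI)
      fix j assume j: "j \<in> N - {k}"
      then obtain i where i: "i \<in> \<F>" "j = (a i, b i)" by (auto simp: N_def)
      then have "i \<noteq> h" using j h(2) by auto
      then show "fst j \<bullet> z < snd j" using zs i by simp
    qed (use h in auto)
  qed
  ultimately show ?thesis using that by blast
qed

text \<open>The equations of \<open>A\<close> as inequalities that are tight on all of
  \<open>A\<close>. Joined to a system of facet inequalities they are active everywhere, which
  transfers the vertex and edge criteria to polyhedra of lower dimension.\<close>

definition affine_rep :: "('a::euclidean_space \<times> real) set \<Rightarrow> 'a set \<Rightarrow> bool" where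
  "affine_rep E A \<longleftrightarrow> finite E \<and> A = hpoly E \<and> (\<forall>h\<in>E. \<forall>x\<in>A. fst h \<bullet> x = snd h)"

lemma affine_rep_exists:
  fixes A :: "'a::euclidean_space set"
  assumes "affine A"
  obtains E where "affine_rep E A"
proof -
  obtain \<F> where \<F>: "finite \<F>" "affine hull A = \<Inter>\<F>"
     "\<And>h. h \<in> \<F> \<Longrightarrow> \<exists>a b. a \<noteq> 0 \<and> h = {x. a \<bullet> x = b}"
    using affine_hull_finite_intersection_hyperplanes[of A] by metis
  then obtain a b where ab: "\<And>h. h \<in> \<F> \<Longrightarrow> h = {x. a h \<bullet> x = b h}" by metis
  define E where "E = (\<lambda>h. (a h, b h)) ` \<F> \<union> (\<lambda>h. (- a h, - b h)) ` \<F>"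
  have A: "x \<in> A \<longleftrightarrow> (\<forall>h\<in>\<F>. a h \<bullet> x = b h)" for x
  proof -
    have "A = \<Inter>\<F>" using \<F>(2) affine_hull_eq[of A] assms by metis
    then have "x \<in> A \<longleftrightarrow> (\<forall>h\<in>\<F>. x \<in> h)" by simp
    also have "\<dots> \<longleftrightarrow> (\<forall>h\<in>\<F>. a h \<bullet> x = b h)" by (intro ball_cong refl) (use ab in blast)
    finally show ?thesis .
  qed
  have "x \<in> hpoly E \<longleftrightarrow> (\<forall>h\<in>\<F>. a h \<bullet> x = b h)" for x
  proof -
    have "x \<in> hpoly E \<longleftrightarrow> (\<forall>h\<in>\<F>. a h \<bullet> x \<le> b h) \<and> (\<forall>h\<in>\<F>. b h \<le> a h \<bullet> x)"
      by (simp add: hpoly_def E_def ball_Un)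
    then show ?thesis by (metis order_antisym order_refl)
  qed
  then have "affine_rep E A" unfolding affine_rep_def using A \<F>(1) by (auto simp: E_def)
  then show ?thesis using that by blast
qed

lemma full_rep_hpoly:
  assumes "full_rep A N P"
  obtains E where "affine_rep E A" "finite (E \<union> N)" "P = hpoly (E \<union> N)"
    "\<And>x. x \<in> A \<Longrightarrow> active (E \<union> N) x = E \<union> active N x"
proof -
  obtain E where E: "affine_rep E A" using affine_rep_exists assms by (auto simp: full_rep_def)
  have "active (E \<union> N) x = E \<union> active N x" if "x \<in> A" for x
    using E that by (auto simp: affine_rep_def active_def)
  moreover have "finite (E \<union> N)" "P = hpoly (E \<union> N)"
    using E assms by (simp_all add: affine_rep_def full_rep_def hpoly_Un)
  ultimately show ?thesis using that[of E] E by blast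
qed

lemma affine_rep_annih:
  assumes "affine_rep E A" "x \<in> A" "y \<in> A"
  shows "y - x \<in> annih E"
  using assms by (auto simp: affine_rep_def annih_def inner_diff_right)

text \<open>Each hyperplane lowers the dimension by at most one, since the common point
  \<open>v\<close> keeps the intersection from being empty.\<close>

lemma aff_dim_Int_hyperplanes:
  fixes A :: "'a::euclidean_space set"
  assumes "affine A" "finite H" "v \<in> A" "\<And>h. h \<in> H \<Longrightarrow> fst h \<bullet> v = snd h"
  shows "aff_dim A \<le> aff_dim (A \<inter> {x. \<forall>h\<in>H. fst h \<bullet> x = snd h}) + int (card H)"
  using assms(2,4)
proof (induction H rule: finite_induct)
  case empty then show ?case by simp
next
  case (insert k H)
  let ?B = "A \<inter> {x. \<forall>h\<in>H. fst h \<bullet> x = snd h}"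
  have eq: "A \<inter> {x. \<forall>h\<in>insert k H. fst h \<bullet> x = snd h} = ?B \<inter> {x. fst k \<bullet> x = snd k}" by auto
  have "affine ?B"
  proof -
    have "?B = A \<inter> (\<Inter>h\<in>H. {x. fst h \<bullet> x = snd h})" by auto
    then show ?thesis using assms(1) by (auto intro!: affine_Int affine_hyperplane affine_Inter)
  qed
  moreover have "v \<in> ?B \<inter> {x. fst k \<bullet> x = snd k}" using insert assms(3) by auto
  ultimately have "aff_dim ?B \<le> aff_dim (?B \<inter> {x. fst k \<bullet> x = snd k}) + 1"
    using aff_dim_affine_Int_hyperplane[of ?B "fst k" "snd k"] by (auto split: if_splits)
  then show ?case unfolding eq using insert by auto
qed

text \<open>A vertex is the only point of \<open>A\<close> on all hyperplanes active at it. In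
  particular fewer inequalities than the dimension leave no vertices, which is the base of the
  recursion.\<close>

lemma vertex_card_active:
  assumes "full_rep A N P" "v \<in> poly_vertices P"
  shows "aff_dim P \<le> int (card (active N v))"
proof -
  obtain E where E: "affine_rep E A" "finite (E \<union> N)" "P = hpoly (E \<union> N)"
    "\<And>x. x \<in> A \<Longrightarrow> active (E \<union> N) x = E \<union> active N x" by (rule full_rep_hpoly[OF assms(1)]) (rule that)
  have v: "v \<in> P" "v \<in> A" using vertex_in[OF assms(2)] assms(1) by (auto simp: full_rep_def)
  have ker: "annih (E \<union> active N v) \<subseteq> {0}" using assms(2) vertex_iff[OF E(2)] E(3,4) v(2) by metis
  have "A \<inter> {x. \<forall>h\<in>active N v. fst h \<bullet> x = snd h} \<subseteq> {v}"
  proof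
    fix y assume y: "y \<in> A \<inter> {x. \<forall>h\<in>active N v. fst h \<bullet> x = snd h}"
    then have "y - v \<in> annih (E \<union> active N v)"
      using affine_rep_annih[OF E(1) v(2), of y] by (auto simp: annih_def active_def inner_diff_right)
    then show "y \<in> {v}" using ker by auto
  qed
  then have "aff_dim (A \<inter> {x. \<forall>h\<in>active N v. fst h \<bullet> x = snd h}) \<le> aff_dim {v}" by (rule aff_dim_subset)
  moreover have "affine A" "finite (active N v)" using full_repD[OF assms(1)] by (simp_all add: finite_active)
  moreover have "\<And>h. h \<in> active N v \<Longrightarrow> fst h \<bullet> v = snd h" by (simp add: active_def)
  ultimately have "aff_dim A \<le> int (card (active N v))"
    using aff_dim_Int_hyperplanes[of A "active N v" v] v(2) by simp
  then show ?thesis using full_rep_aff_dim[OF assms(1)] by simp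
qed

section \<open>Passing to faces, and a simplex as standard example\<close>

lemma poly_adj_face:
  assumes "F face_of P" "poly_adj F x y"
  shows "poly_adj P x y"
  using assms by (auto simp: poly_adj_def edge_of_def poly_vertices_def extreme_point_of_face dest: face_of_trans)

lemma vertices_face: "F face_of P \<Longrightarrow> poly_vertices F = poly_vertices P \<inter> F"
  by (auto simp: poly_vertices_def extreme_point_of_face)

lemma graph_dist_face: "F face_of P \<Longrightarrow> graph_dist P x y \<le> graph_dist F x y"
  by (rule graph_dist_geI, rule graph_dist_le, rule relpowp_mono[OF poly_adj_face])

lemma graph_diameter_le_Delta:
  fixes P :: "'a::euclidean_space set"
  assumes "polyhedron P" "aff_dim P = int d" "card (facets P) = n"
  shows "graph_diameter P \<le> Delta_u TYPE('a) d n"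
  unfolding Delta_u_def using assms by (intro SUP_upper) (auto simp: polyhedra_def facets_def)

text \<open>Two distinct vertices with the least possible number of facets: the convex hull of 0 and
  \<open>m\<close> basis vectors. It yields the positive lower bounds for
  \<open>Delta_u\<close>.\<close>

lemma simplex_polyhedron:
  assumes "1 \<le> m" "m \<le> DIM('a::euclidean_space)"
  obtains P :: "'a::euclidean_space set" and x y where "polyhedron P" "aff_dim P = int m" "card (facets P) = Suc m"
    "x \<in> poly_vertices P" "y \<in> poly_vertices P" "x \<noteq> y"
proof -
  obtain B :: "'a set" where B: "B \<subseteq> Basis" "card B = m"
    using assms(2) obtain_subset_with_card_n by blast
  have fB: "finite B" using B(1) finite_Basis finite_subset by blast
  have "0 \<notin> B" using B(1) nonzero_Basis by blast
  have "independent B" using B(1) independent_Basis independent_mono by blast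
  define C where "C = insert 0 B"
  have ind: "\<not> affine_dependent C"
    unfolding C_def using affine_dependent_iff_dependent[OF \<open>0 \<notin> B\<close>] \<open>independent B\<close> by (simp add: image_def)
  have fC: "finite C" and cC: "card C = Suc m" using fB B(2) \<open>0 \<notin> B\<close> by (auto simp: C_def)
  define P where "P = convex hull C"
  have ext: "z extreme_point_of (convex hull D) \<longleftrightarrow> z \<in> D" if "D \<subseteq> C" for D z
    using extreme_point_of_convex_hull_affine_independent affine_independent_subset[OF ind that] by blast
  have "facets P = (\<lambda>u. convex hull (C - {u})) ` C"
  proof -
    have "convex hull (C - {u}) \<noteq> {}" for u
    proof -
      have "card (C - {u}) \<ge> 1" using cC assms(1) fC by (simp add: card_Diff_singleton_if)
      then have "C - {u} \<noteq> {}" by (metis card.empty not_one_le_zero)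
      then show ?thesis by simp
    qed
    then show ?thesis unfolding facets_def P_def facet_of_convex_hull_affine_independent[OF ind] by blast
  qed
  moreover have "inj_on (\<lambda>u. convex hull (C - {u})) C"
  proof (rule inj_onI)
    fix u w assume uw: "u \<in> C" "w \<in> C" and eq: "convex hull (C - {u}) = convex hull (C - {w})"
    then have "u \<in> C - {u} \<longleftrightarrow> u \<in> C - {w}" using ext[of "C - {u}" u] ext[of "C - {w}" u] by auto
    then show "u = w" using uw by blast
  qed
  ultimately have "card (facets P) = Suc m" using cC by (simp add: card_image)
  moreover have "polyhedron P" unfolding P_def using fC by (rule polyhedron_convex_hull)
  moreover have "aff_dim P = int m" unfolding P_def aff_dim_convex_hull using aff_dim_affine_independent[OF ind] cC by simp
  moreover have "poly_vertices P = C" using ext[of C] by (auto simp: poly_vertices_def P_def)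
  moreover obtain b where "b \<in> B" using assms(1) B(2) by (metis card.empty not_one_le_zero ex_in_conv)
  ultimately show ?thesis using that[of P 0 b] \<open>0 \<notin> B\<close> by (auto simp: C_def)
qed

section \<open>Truncation of a vertex\<close>

lemma active_insert: "active (insert (g, b) S) x = (if g \<bullet> x = b then insert (g, b) (active S x) else active S x)"
  by (auto simp: active_def)

text \<open>A functional \<open>g\<close> exposes \<open>v\<close>, and the cut is placed so close
  to \<open>v\<close> that everything worth keeping stays strictly on the other side. The parameter
  \<open>\<eta>\<close> lets the caller limit how far along \<open>r\<close> the new vertex
  lies.\<close>

lemma truncate_vertex:
  fixes P :: "'a::euclidean_space set"
  assumes fr: "full_rep A N P" and ir: "irredundant A N" and dim: "2 \<le> aff_dim P" and E: "affine_rep E A"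
    and v: "v \<in> poly_vertices P" and r: "edge_dir (E \<union> N) v r" and "\<eta> > 0"
  obtains g b \<delta> where "0 < \<delta>" "\<delta> < \<eta>" "(g, b) \<notin> N" "full_rep A (insert (g, b) N) (P \<inter> {x. g \<bullet> x \<le> b})"
    "irredundant A (insert (g, b) N)"
    "v + \<delta> *\<^sub>R r \<in> poly_vertices (P \<inter> {x. g \<bullet> x \<le> b})" "g \<bullet> (v + \<delta> *\<^sub>R r) = b"
    "\<And>x. x \<in> poly_vertices P \<Longrightarrow> x \<noteq> v \<Longrightarrow> x \<in> poly_vertices (P \<inter> {x. g \<bullet> x \<le> b}) \<and> g \<bullet> x < b"
    "\<And>x y. poly_adj (P \<inter> {x. g \<bullet> x \<le> b}) x y \<Longrightarrow> g \<bullet> x < b \<Longrightarrow> g \<bullet> y < b \<Longrightarrow> poly_adj P x y"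
    "\<And>x y. poly_adj (P \<inter> {x. g \<bullet> x \<le> b}) x y \<Longrightarrow> g \<bullet> x < b \<Longrightarrow> g \<bullet> y = b \<Longrightarrow>
       poly_adj P x v \<and> y \<in> open_segment v x"
proof -
  let ?S = "E \<union> N"
  have fS: "finite ?S" using full_repD(2)[OF fr] E by (simp add: affine_rep_def)
  have PS: "P = hpoly ?S" using full_repD(3)[OF fr] E by (simp add: affine_rep_def hpoly_Un)
  have A: "affine A" using full_repD[OF fr] by simp
  have vP: "v \<in> P" "v \<in> A" using vertex_in[OF v] full_repD(3)[OF fr] by auto
  have vS: "v \<in> poly_vertices (hpoly ?S)" using v PS by simp
  obtain g \<kappa> where \<kappa>: "\<kappa> > 0"
    and gc: "\<And>z. (\<And>h. h \<in> active ?S v \<Longrightarrow> fst h \<bullet> z \<le> 0) \<Longrightarrow> g \<bullet> z \<le> - \<kappa> * norm z"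
    and gP: "\<And>z. z \<in> hpoly ?S \<Longrightarrow> g \<bullet> z \<le> g \<bullet> v - \<kappa> * norm (z - v)"
    by (rule vertex_exposed[OF fS vS]) (rule that; blast)
  have gle: "g \<bullet> z \<le> g \<bullet> v" if "z \<in> P" for z
  proof -
    have "0 \<le> \<kappa> * norm (z - v)" using \<kappa> by simp
    then show ?thesis using gP[OF that[unfolded PS]] by linarith
  qed
  have glt: "g \<bullet> z < g \<bullet> v" if "z \<in> P" "z \<noteq> v" for z
  proof -
    have "0 < \<kappa> * norm (z - v)" using \<kappa> that(2) by simp
    then show ?thesis using gP[OF that(1)[unfolded PS]] by linarith
  qed
  have gr: "g \<bullet> r < 0"
  proof -
    have "g \<bullet> r \<le> - \<kappa> * norm r" using gc r unfolding edge_dir_def by blast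
    moreover have "\<kappa> * norm r > 0" using \<kappa> r by (simp add: edge_dir_def)
    ultimately show ?thesis by simp
  qed
  obtain e where e: "e > 0" "\<And>t. 0 \<le> t \<Longrightarrow> t \<le> e \<Longrightarrow> v + t *\<^sub>R r \<in> hpoly ?S"
    using hpoly_small_step[OF fS vertex_in[OF vS], of r] r unfolding edge_dir_def by blast
  obtain x0 where x0: "x0 \<in> A" "\<And>h. h \<in> N \<Longrightarrow> fst h \<bullet> x0 < snd h" using fr unfolding full_rep_def by blast
  have "\<forall>h\<in>N. \<exists>z\<in>A. fst h \<bullet> z = snd h \<and> (\<forall>k\<in>N - {h}. fst k \<bullet> z < snd k)"
    using ir by (simp add: irredundant_def)
  then obtain z where z: "\<And>h. h \<in> N \<Longrightarrow> z h \<in> A" "\<And>h. h \<in> N \<Longrightarrow> fst h \<bullet> z h = snd h"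
      "\<And>h k. h \<in> N \<Longrightarrow> k \<in> N \<Longrightarrow> k \<noteq> h \<Longrightarrow> fst k \<bullet> z h < snd k"
    by (metis DiffI singletonD)
  \<comment> \<open>Dimension at least 2 gives two active inequalities at \<open>v\<close>. A
    witness point has only one, so it differs from \<open>v\<close> and can be kept by the
    cut.\<close>
  have two: "2 \<le> card (active N v)" using vertex_card_active[OF fr v] dim by linarith
  have act2: "\<exists>k \<in> active N v. k \<noteq> h" for h
  proof (rule ccontr)
    assume "\<not> ?thesis"
    then have "active N v \<subseteq> {h}" by blast
    then have "card (active N v) \<le> 1" using card_mono[of "{h}"] by fastforce
    then show False using two by simp
  qed
  have x0P: "x0 \<in> P" "x0 \<noteq> v"
  proof -
    show "x0 \<in> P" using full_rep_in[OF fr] x0 by (simp add: less_imp_le)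
    obtain k where "k \<in> active N v" using act2[of undefined] by blast
    then show "x0 \<noteq> v" using x0(2)[of k] by (auto simp: active_def)
  qed
  have zP: "z h \<in> P" "z h \<noteq> v" if h: "h \<in> N" for h
  proof -
    have "fst k \<bullet> z h \<le> snd k" if "k \<in> N" for k
      using z(2)[OF h] z(3)[OF h that] by (cases "k = h") auto
    then show "z h \<in> P" using full_rep_in[OF fr] z(1)[OF h] by blast
    obtain k where "k \<in> active N v" "k \<noteq> h" using act2[of h] by blast
    then show "z h \<noteq> v" using z(3)[OF h, of k] by (auto simp: active_def)
  qed
  \<comment> \<open>The points to be kept: the strict point, the witnesses of irredundancy and all
    other vertices.\<close>
  define W where "W = {x0} \<union> z ` N \<union> (poly_vertices P - {v})"
  have fW: "finite W" using full_repD(2)[OF fr] finite_vertices[OF full_rep_polyhedron[OF fr]] by (simp add: W_def)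
  have Wne: "W \<noteq> {}" by (simp add: W_def)
  have Wlt: "g \<bullet> x < g \<bullet> v" if "x \<in> W" for x
    using that glt[of x] x0P zP vertex_in[of x P] by (auto simp: W_def)
  define M where "M = Max ((\<bullet>) g ` W)"
  have M: "M < g \<bullet> v" "\<And>x. x \<in> W \<Longrightarrow> g \<bullet> x \<le> M"
    using fW Wne Wlt by (auto simp: M_def)
  \<comment> \<open>The bound \<open>e\<close> keeps the new vertex feasible; the last bound keeps
    the level \<open>b\<close> at least halfway from \<open>M\<close> to
    \<open>g \<bullet> v\<close>, hence above all of \<open>W\<close>.\<close>
  define \<delta> where "\<delta> = min (\<eta> / 2) (min e ((g \<bullet> v - M) / (2 * (- (g \<bullet> r)))))"
  have \<delta>: "0 < \<delta>" "\<delta> < \<eta>" "\<delta> \<le> e" "\<delta> \<le> (g \<bullet> v - M) / (2 * (- (g \<bullet> r)))"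
    using \<open>\<eta> > 0\<close> e(1) M(1) gr by (auto simp: \<delta>_def divide_pos_neg)
  define b where "b = g \<bullet> (v + \<delta> *\<^sub>R r)"
  have b: "b = g \<bullet> v + \<delta> * (g \<bullet> r)" by (simp add: b_def inner_add_right)
  have bv: "b < g \<bullet> v" using \<delta>(1) gr by (simp add: b mult_pos_neg)
  have bM: "M < b"
  proof -
    have "\<delta> * (- (g \<bullet> r)) \<le> (g \<bullet> v - M) / 2" using \<delta>(4) gr by (simp add: field_simps)
    then show ?thesis using M(1) by (simp add: b)
  qed
  have Wb: "g \<bullet> x < b" if "x \<in> W" for x using M(2)[OF that] bM by simp
  have nS: "(g, b) \<notin> ?S" using hpolyD[OF vertex_in[OF vS], of "(g, b)"] bv by auto
  let ?P = "P \<inter> {x. g \<bullet> x \<le> b}" and ?N = "insert (g, b) N" and ?T = "insert (g, b) ?S"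
  have PT: "?P = hpoly ?T" by (auto simp: hpoly_insert PS)
  have fT: "finite ?T" using fS by simp
  have rep': "full_rep A ?N ?P"
    unfolding full_rep_def
  proof (intro conjI)
    show "?P = A \<inter> hpoly ?N" using full_repD(3)[OF fr] by (auto simp: hpoly_insert)
    show "\<exists>x\<in>A. \<forall>h\<in>?N. fst h \<bullet> x < snd h" using x0 Wb[of x0] by (intro bexI[of _ x0]) (auto simp: W_def)
  qed (use A full_repD(2)[OF fr] in auto)
  have irr': "irredundant A ?N"
    unfolding irredundant_def
  proof
    fix h assume h: "h \<in> ?N"
    show "\<exists>z\<in>A. fst h \<bullet> z = snd h \<and> (\<forall>k\<in>?N - {h}. fst k \<bullet> z < snd k)"
    proof (cases "h \<in> N")
      case True
      then have "g \<bullet> z h < b" using Wb[of "z h"] by (auto simp: W_def)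
      then show ?thesis using z(1,2)[OF True] z(3)[OF True] by (intro bexI[of _ "z h"]) auto
    next
      case False
      then have h: "h = (g, b)" using h by simp
      \<comment> \<open>The witness for the new inequality is the point where the segment from
        \<open>v\<close> to the strict point \<open>x0\<close> crosses the cut; all old inequalities
        are strict there.\<close>
      define s where "s = (g \<bullet> v - b) / (g \<bullet> v - g \<bullet> x0)"
      have gx0: "g \<bullet> x0 < b" using Wb[of x0] by (simp add: W_def)
      have s: "0 < s" "s < 1" using bv gx0 by (auto simp: s_def divide_simps)
      let ?y = "(1 - s) *\<^sub>R v + s *\<^sub>R x0"
      have "?y \<in> A" using A vP(2) x0(1) mem_affine[of A v x0 "1 - s" s] by simp
      moreover have "g \<bullet> ?y = b"
      proof -
        have "g \<bullet> ?y = g \<bullet> v - s * (g \<bullet> v - g \<bullet> x0)" by (simp add: inner_add_right algebra_simps)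
        then show ?thesis using bv gx0 by (simp add: s_def)
      qed
      moreover have "fst k \<bullet> ?y < snd k" if "k \<in> N" for k
      proof -
        have "(1 - s) * (fst k \<bullet> v) \<le> (1 - s) * snd k"
          using full_rep_in[OF fr, of v] vP that s by (intro mult_left_mono) auto
        moreover have "s * (fst k \<bullet> x0) < s * snd k" using x0(2)[OF that] s by simp
        ultimately have "fst k \<bullet> ?y < (1 - s) * snd k + s * snd k" by (simp add: inner_add_right)
        then show ?thesis by (simp add: algebra_simps)
      qed
      ultimately show ?thesis unfolding h by (intro bexI[of _ ?y]) auto
    qed
  qed
  \<comment> \<open>Strictly below the cut the new inequality is inactive, so the vertex criterion
    is unchanged.\<close>
  have vert: "x \<in> poly_vertices ?P \<longleftrightarrow> x \<in> poly_vertices P" if "g \<bullet> x < b" for x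
    unfolding PT unfolding PS vertex_iff[OF fT] vertex_iff[OF fS] using that
    by (auto simp: active_insert hpoly_insert)
  have vertW: "x \<in> poly_vertices ?P \<and> g \<bullet> x < b" if "x \<in> poly_vertices P" "x \<noteq> v" for x
    using Wb[of x] vert[of x] that by (auto simp: W_def)
  have p0: "v + \<delta> *\<^sub>R r \<in> poly_vertices ?P"
    unfolding PT vertex_iff[OF fT]
  proof (intro conjI subsetI)
    show "v + \<delta> *\<^sub>R r \<in> hpoly ?T" using e(2)[of \<delta>] \<delta> by (simp add: hpoly_insert b_def)
    fix y assume y: "y \<in> annih (active ?T (v + \<delta> *\<^sub>R r))"
    have "{h \<in> active ?S v. fst h \<bullet> r = 0} \<subseteq> active ?T (v + \<delta> *\<^sub>R r)"
      by (auto simp: active_def inner_add_right)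
    then have "y \<in> span {r}" using y r annih_antimono unfolding edge_dir_def by blast
    then obtain k where k: "y = k *\<^sub>R r" by (auto simp: span_singleton)
    have "(g, b) \<in> active ?T (v + \<delta> *\<^sub>R r)" by (auto simp: active_def b_def)
    then have "g \<bullet> y = 0" using y by (force simp: annih_def)
    then show "y \<in> {0}" using gr k by simp
  qed
  have old_old: "poly_adj P x y" if "poly_adj ?P x y" "g \<bullet> x < b" "g \<bullet> y < b" for x y
  proof -
    have "annih (active ?T x \<inter> active ?T y) \<subseteq> span {y - x}" "x \<noteq> y" using that(1) unfolding PT adj_iff[OF fT] by auto
    then have "annih (active ?S x \<inter> active ?S y) \<subseteq> span {y - x}" using that(2,3) by (simp add: active_insert)
    then show ?thesis
      using vert[OF that(2)] vert[OF that(3)] poly_adj_vertices[OF that(1)] \<open>x \<noteq> y\<close>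
      unfolding PS adj_iff[OF fS] by blast
  qed
  have old_new: "poly_adj P x v \<and> y \<in> open_segment v x" if "poly_adj ?P x y" "g \<bullet> x < b" "g \<bullet> y = b" for x y
  proof -
    have ker: "annih (active ?T x \<inter> active ?T y) \<subseteq> span {y - x}" and ne: "x \<noteq> y"
      using that(1) unfolding PT adj_iff[OF fT] by auto
    have xv: "x \<in> poly_vertices P" using vert[OF that(2)] poly_adj_vertices[OF that(1)] by blast
    have yP: "y \<in> P" using poly_adj_vertices[OF that(1)] vertex_in by blast
    have "active ?T x \<inter> active ?T y = active ?S x \<inter> active ?S y" using that(2,3) nS by (auto simp: active_insert active_def)
    moreover have "{h \<in> active ?S x. fst h \<bullet> (y - x) = 0} = active ?S x \<inter> active ?S y"
      by (auto simp: active_def inner_diff_right)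
    moreover have "\<forall>h\<in>active ?S x. fst h \<bullet> (y - x) \<le> 0" using active_diff_le[of y ?S] yP PS by blast
    ultimately have dir: "edge_dir ?S x (y - x)" using ker ne unfolding edge_dir_def by simp
    have gyx: "g \<bullet> (y - x) > 0" using that by (simp add: inner_diff_right)
    \<comment> \<open>On the ray from \<open>x\<close> through \<open>y\<close> the functional
      \<open>g\<close> increases, but it is bounded by its value at \<open>v\<close>. The edge of
      \<open>P\<close> therefore ends, at or above the cut, and \<open>v\<close> is the only vertex
      there.\<close>
    have "\<not> (\<forall>t\<ge>0. x + t *\<^sub>R (y - x) \<in> hpoly ?S)"
    proof
      assume *: "\<forall>t\<ge>0. x + t *\<^sub>R (y - x) \<in> hpoly ?S"
      let ?t = "(g \<bullet> v - g \<bullet> x + 1) / (g \<bullet> (y - x))"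
      have "?t \<ge> 0" using gyx gle[of x] vertex_in[OF xv] by simp
      then have "g \<bullet> (x + ?t *\<^sub>R (y - x)) \<le> g \<bullet> v" using * gle PS by blast
      then show False using gyx by (simp add: inner_add_right)
    qed
    then obtain t where t: "t > 0" "poly_adj (hpoly ?S) x (x + t *\<^sub>R (y - x))"
      "\<And>s. s > t \<Longrightarrow> x + s *\<^sub>R (y - x) \<notin> hpoly ?S"
      using edge_ends[OF fS _ dir] xv PS by blast
    have "t \<ge> 1" using t(3)[of 1] yP PS by force
    let ?w = "x + t *\<^sub>R (y - x)"
    have wv: "?w \<in> poly_vertices P" using poly_adj_vertices[OF t(2)] PS by simp
    have "g \<bullet> ?w = b + (t - 1) * (g \<bullet> (y - x))"
      using that(3) by (simp add: inner_add_right inner_diff_right algebra_simps)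
    then have "g \<bullet> ?w \<ge> b" using \<open>t \<ge> 1\<close> gyx by simp
    then have w: "?w = v" using vertW[OF wv] by fastforce
    have "t \<noteq> 1" using w that(3) bv by auto
    then have "t > 1" using \<open>t \<ge> 1\<close> by simp
    have "y = (1 - (1 - 1/t)) *\<^sub>R v + (1 - 1/t) *\<^sub>R x"
    proof -
      have "(1 - (1 - 1/t)) *\<^sub>R v + (1 - 1/t) *\<^sub>R x = x + (1/t) *\<^sub>R (v - x)" by (simp add: algebra_simps)
      also have "v - x = t *\<^sub>R (y - x)" using w by (simp add: algebra_simps)
      finally show ?thesis using \<open>t > 1\<close> by simp
    qed
    moreover have "v \<noteq> x" using t(2) w by (auto simp: poly_adj_def)
    ultimately have "y \<in> open_segment v x"
      using \<open>t > 1\<close> unfolding in_segment by (intro conjI exI[of _ "1 - 1/t"]) auto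
    then show ?thesis using t(2) w PS by simp
  qed
  show ?thesis
  proof (rule that[of \<delta> g b])
    show "(g, b) \<notin> N" using nS by blast
    show "g \<bullet> (v + \<delta> *\<^sub>R r) = b" by (simp add: b_def)
  qed (fact \<delta> rep' irr' p0 vertW old_old old_new)+
qed

text \<open>A natural number, as potentials require. It is meaningful between vertices, where
  connectivity makes the distance finite.\<close>

definition vdist :: "'a::euclidean_space set \<Rightarrow> 'a \<Rightarrow> 'a \<Rightarrow> nat" where
  "vdist P u x = the_enat (graph_dist P u x)"

lemma vdist:
  assumes "polyhedron P" "u \<in> poly_vertices P" "x \<in> poly_vertices P"
  shows "graph_dist P u x = enat (vdist P u x)" "(poly_adj P ^^ vdist P u x) u x"
proof -
  have "P \<noteq> {}" using vertex_in[OF assms(2)] by blast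
  then obtain N where "full_rep (affine hull P) N P" using polyhedron_full_rep[OF assms(1)] by blast
  then obtain E where "finite (E \<union> N)" "P = hpoly (E \<union> N)" using full_rep_hpoly by metis
  then obtain j where "(poly_adj P ^^ j) u x" using vertices_connected assms(2,3) by metis
  then obtain k where "(poly_adj P ^^ k) u x" "graph_dist P u x = enat k" by (rule graph_dist_attained)
  then show "graph_dist P u x = enat (vdist P u x)" "(poly_adj P ^^ vdist P u x) u x"
    by (simp_all add: vdist_def)
qed

lemma vdist_le:
  assumes "(poly_adj P ^^ k) u x"
  shows "vdist P u x \<le> k"
  using graph_dist_le[OF assms] graph_dist_attained[OF assms] unfolding vdist_def
  by (metis enat_ord_simps(1) the_enat.simps)

lemma vdist_self: "vdist P u u = 0"
  using vdist_le[of 0 P u u] by simp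

lemma vdist_step:
  assumes "polyhedron P" "u \<in> poly_vertices P" "poly_adj P x y"
  shows "vdist P u y \<le> Suc (vdist P u x)"
proof -
  have "(poly_adj P ^^ vdist P u x) u x" using vdist(2)[OF assms(1,2)] poly_adj_vertices[OF assms(3)] by blast
  then show ?thesis using vdist_le relpowp_Suc_I assms(3) by metis
qed

lemma graph_dist_pos: "x \<noteq> y \<Longrightarrow> 1 \<le> graph_dist P x y"
proof (rule graph_dist_geI)
  fix k assume "x \<noteq> y" "(poly_adj P ^^ k) x y"
  then have "k \<noteq> 0" by (auto intro: ccontr)
  then show "1 \<le> enat k" by (simp add: one_enat_def)
qed

text \<open>Distances from \<open>u\<close> do not shrink: identifying all new vertices with
  \<open>v\<close> turns an edge of the truncation into an edge of \<open>P\<close> or a standstill.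
  The conclusion keeps two distinct vertices so that the step can be iterated.\<close>

lemma add_facet:
  fixes P :: "'a::euclidean_space set"
  assumes P: "polyhedron P" "2 \<le> aff_dim P" and uv: "u \<in> poly_vertices P" "v \<in> poly_vertices P" "u \<noteq> v"
  obtains P' :: "'a set" and v' where "polyhedron P'" "aff_dim P' = aff_dim P" "card (facets P') = Suc (card (facets P))"
    "u \<in> poly_vertices P'" "v' \<in> poly_vertices P'" "u \<noteq> v'" "graph_dist P u v \<le> graph_dist P' u v'"
proof -
  have "P \<noteq> {}" using vertex_in[OF uv(1)] by blast
  then obtain N where N: "full_rep (affine hull P) N P" "irredundant (affine hull P) N" using polyhedron_full_rep[OF P(1)] by blast
  let ?A = "affine hull P"
  obtain E where E: "affine_rep E ?A" "finite (E \<union> N)" "P = hpoly (E \<union> N)" using full_rep_hpoly[OF N(1)] by metis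
  \<comment> \<open>Any edge direction at \<open>v\<close> will do; improving towards
    \<open>u\<close> guarantees that one exists.\<close>
  have "(u - v) \<bullet> v < (u - v) \<bullet> u"
  proof -
    have "(u - v) \<bullet> (u - v) > 0" using uv(3) by simp
    then show ?thesis by (simp add: inner_diff_right)
  qed
  then obtain r where r: "edge_dir (E \<union> N) v r"
    using improving_edge_dir[OF E(2), of v u "u - v"] uv E(3) vertex_in[OF uv(1)] by metis
  obtain g b \<delta> where T: "(g, b) \<notin> N" "full_rep ?A (insert (g, b) N) (P \<inter> {x. g \<bullet> x \<le> b})"
    "irredundant ?A (insert (g, b) N)"
    "v + \<delta> *\<^sub>R r \<in> poly_vertices (P \<inter> {x. g \<bullet> x \<le> b})" "g \<bullet> (v + \<delta> *\<^sub>R r) = b"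
    "\<And>x. x \<in> poly_vertices P \<Longrightarrow> x \<noteq> v \<Longrightarrow> x \<in> poly_vertices (P \<inter> {x. g \<bullet> x \<le> b}) \<and> g \<bullet> x < b"
    "\<And>x y. poly_adj (P \<inter> {x. g \<bullet> x \<le> b}) x y \<Longrightarrow> g \<bullet> x < b \<Longrightarrow> g \<bullet> y < b \<Longrightarrow> poly_adj P x y"
    "\<And>x y. poly_adj (P \<inter> {x. g \<bullet> x \<le> b}) x y \<Longrightarrow> g \<bullet> x < b \<Longrightarrow> g \<bullet> y = b \<Longrightarrow>
       poly_adj P x v \<and> y \<in> open_segment v x"
    by (rule truncate_vertex[OF N P(2) E(1) uv(2) r zero_less_one]) (rule that)
  let ?P = "P \<inter> {x. g \<bullet> x \<le> b}" and ?v = "v + \<delta> *\<^sub>R r"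
  let ?d = "vdist P u"
  define f where "f x = (if g \<bullet> x < b then ?d x else ?d v)" for x
  have u': "u \<in> poly_vertices ?P" "g \<bullet> u < b" using T(6)[OF uv(1,3)] by auto
  have "enat (f ?v) \<le> graph_dist ?P u ?v"
  proof (rule graph_dist_ge_potential)
    show "f u = 0" using u' by (simp add: f_def vdist_self)
    fix p q assume pq: "poly_adj ?P p q"
    then have qp: "poly_adj ?P q p" by (rule poly_adj_sym)
    have "p \<in> ?P" "q \<in> ?P" using poly_adj_vertices[OF pq] vertex_in by blast+
    then have le: "g \<bullet> p \<le> b" "g \<bullet> q \<le> b" by auto
    show "f q \<le> Suc (f p)"
    proof (cases "g \<bullet> p < b"; cases "g \<bullet> q < b")
      assume "g \<bullet> p < b" "g \<bullet> q < b"
      then show ?thesis using vdist_step[OF P(1) uv(1) T(7)[OF pq]] by (simp add: f_def)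
    next
      assume *: "g \<bullet> p < b" "\<not> g \<bullet> q < b"
      then have "poly_adj P p v" using T(8)[OF pq] le by auto
      then show ?thesis using vdist_step[OF P(1) uv(1), of p v] * by (simp add: f_def)
    next
      assume *: "\<not> g \<bullet> p < b" "g \<bullet> q < b"
      then have "poly_adj P q v" using T(8)[OF qp] le by auto
      then have "poly_adj P v q" by (rule poly_adj_sym)
      then show ?thesis using vdist_step[OF P(1) uv(1), of v q] * by (simp add: f_def)
    qed (simp add: f_def)
  qed
  moreover have "f ?v = ?d v" unfolding f_def T(5) by simp
  ultimately have "graph_dist P u v \<le> graph_dist ?P u ?v"
    unfolding vdist(1)[OF P(1) uv(1,2)] by metis
  moreover have "card (facets ?P) = Suc (card (facets P))"
    using card_facets_eq[OF T(2,3)] card_facets_eq[OF N] T(1) full_repD(2)[OF N(1)] by simp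
  moreover have "aff_dim ?P = aff_dim P" using full_rep_aff_dim[OF T(2)] by simp
  moreover have "u \<noteq> ?v" using u'(2) T(5) by auto
  ultimately show ?thesis using that[of ?P ?v] full_rep_polyhedron[OF T(2)] u'(1) T(4) by blast
qed

lemma add_facets:
  fixes P :: "'a::euclidean_space set"
  assumes "polyhedron P" "2 \<le> aff_dim P" "u \<in> poly_vertices P" "v \<in> poly_vertices P" "u \<noteq> v"
  shows "\<exists>P' v'. polyhedron P' \<and> aff_dim P' = aff_dim P \<and> card (facets P') = card (facets P) + k \<and>
    u \<in> poly_vertices P' \<and> v' \<in> poly_vertices P' \<and> u \<noteq> v' \<and> graph_dist P u v \<le> graph_dist P' u v'"
proof (induction k)
  case 0 then show ?case using assms by auto
next
  case (Suc k)
  then obtain P' v' where *: "polyhedron P'" "aff_dim P' = aff_dim P" "card (facets P') = card (facets P) + k"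
    "u \<in> poly_vertices P'" "v' \<in> poly_vertices P'" "u \<noteq> v'" "graph_dist P u v \<le> graph_dist P' u v'" by blast
  have "2 \<le> aff_dim P'" using *(2) assms(2) by simp
  then obtain Q w where "polyhedron Q" "aff_dim Q = aff_dim P'" "card (facets Q) = Suc (card (facets P'))"
    "u \<in> poly_vertices Q" "w \<in> poly_vertices Q" "u \<noteq> w" "graph_dist P' u v' \<le> graph_dist Q u w"
    using add_facet[OF *(1) _ *(4-6)] by blast
  then show ?case using * by (intro exI[of _ Q] exI[of _ w]) auto
qed

text \<open>Truncations pad the polyhedron to exactly \<open>n\<close> facets, as the definition of
  \<open>Delta_u\<close> demands.\<close>

lemma graph_dist_le_Delta:
  fixes P :: "'a::euclidean_space set"
  assumes "polyhedron P" "aff_dim P = int m" "2 \<le> m" "u \<in> poly_vertices P" "v \<in> poly_vertices P" "u \<noteq> v"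
    and "card (facets P) \<le> n"
  shows "graph_dist P u v \<le> Delta_u TYPE('a) m n"
proof -
  obtain Q :: "'a set" and w where Q: "polyhedron Q" "aff_dim Q = aff_dim P" "card (facets Q) = card (facets P) + (n - card (facets P))"
    "u \<in> poly_vertices Q" "w \<in> poly_vertices Q" "graph_dist P u v \<le> graph_dist Q u w"
    using add_facets[OF assms(1) _ assms(4-6), of "n - card (facets P)"] assms(2,3) by auto
  have "graph_dist Q u w \<le> graph_diameter Q" using graph_dist_le_diameter Q by blast
  also have "\<dots> \<le> Delta_u TYPE('a) m n" using graph_diameter_le_Delta[OF Q(1)] Q(2,3) assms(2,7) by simp
  finally show ?thesis using Q(6) by simp
qed

section \<open>Strict monotonicity in the number of facets\<close>

text \<open>
  The projective map fixing \<open>w\<close> that sends the hyperplane \<open>c \<bullet> (x - w) = 1\<close> to infinity, with inverse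
  \<open>proj_map w (- c)\<close>.  On this hyperplane itself division by zero gives \<open>w\<close>.
\<close>

definition proj_map :: "'a::euclidean_space \<Rightarrow> 'a \<Rightarrow> 'a \<Rightarrow> 'a" where
  "proj_map w c x = w + (1 / (1 - c \<bullet> (x - w))) *\<^sub>R (x - w)"

section \<open>The projective map on its half-space and on segments\<close>

lemma proj_diff: "proj_map w c x - w = (1 / (1 - c \<bullet> (x - w))) *\<^sub>R (x - w)"
  by (simp add: proj_map_def)

text \<open>The denominators of the maps for \<open>c\<close> and \<open>- c\<close> are reciprocal,
  which makes the maps inverse to each other on their half-spaces.\<close>

lemma proj_denominator:
  assumes "c \<bullet> (x - w) < 1"
  shows "1 - (- c) \<bullet> (proj_map w c x - w) = 1 / (1 - c \<bullet> (x - w))"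
proof -
  have "1 + (1 / (1 - s)) * s = 1 / (1 - s)" if "s < 1" for s :: real
    using that by (simp add: divide_simps)
  from this[OF assms] show ?thesis unfolding proj_diff by simp
qed

lemma proj_dom: "c \<bullet> (x - w) < 1 \<Longrightarrow> (- c) \<bullet> (proj_map w c x - w) < 1"
  using proj_denominator[of c x w] by (smt (verit) zero_less_divide_1_iff)

lemma proj_inverse:
  assumes "c \<bullet> (x - w) < 1"
  shows "proj_map w (- c) (proj_map w c x) = x"
proof -
  have "proj_map w (- c) (proj_map w c x) = w + (1 - c \<bullet> (x - w)) *\<^sub>R (proj_map w c x - w)"
    unfolding proj_map_def[of w "- c"] proj_denominator[OF assms] by simp
  also have "\<dots> = x" using assms by (simp add: proj_diff)
  finally show ?thesis .
qed

lemma proj_self: "proj_map w c w = w"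
  by (simp add: proj_map_def)

text \<open>Where the denominators are positive, a segment goes to a segment; only its parameter is
  reweighted by the denominators at the end points.\<close>

lemma proj_open_segment:
  assumes a: "c \<bullet> (a - w) < 1" and b: "c \<bullet> (b - w) < 1" and x: "x \<in> open_segment a b"
  shows "c \<bullet> (x - w) < 1" "proj_map w c x \<in> open_segment (proj_map w c a) (proj_map w c b)"
proof -
  obtain u where u: "0 < u" "u < 1" "x = (1 - u) *\<^sub>R a + u *\<^sub>R b" "a \<noteq> b" using x by (auto simp: in_segment)
  define sa sb sx where "sa = 1 - c \<bullet> (a - w)" and "sb = 1 - c \<bullet> (b - w)" and "sx = 1 - c \<bullet> (x - w)"
  have pos: "0 < sa" "0 < sb" using a b by (auto simp: sa_def sb_def)
  have sx: "sx = (1 - u) * sa + u * sb"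
    by (simp add: sx_def sa_def sb_def u(3) inner_diff_right inner_add_right algebra_simps)
  have sxpos: "0 < sx" unfolding sx using pos u by (intro add_pos_pos mult_pos_pos) auto
  then show "c \<bullet> (x - w) < 1" by (simp add: sx_def)
  define t where "t = u * sb / sx"
  have t: "0 < t" "t < 1" "1 - t = (1 - u) * sa / sx"
    using pos u sxpos by (auto simp: t_def sx divide_simps intro!: mult_pos_pos)
  have "proj_map w c x = (1 - t) *\<^sub>R proj_map w c a + t *\<^sub>R proj_map w c b"
  proof -
    have "(1 - t) *\<^sub>R proj_map w c a + t *\<^sub>R proj_map w c b = w + (1 - t) *\<^sub>R (proj_map w c a - w) + t *\<^sub>R (proj_map w c b - w)"
      by (simp add: algebra_simps)
    also have "(1 - t) *\<^sub>R (proj_map w c a - w) = ((1 - u) / sx) *\<^sub>R (a - w)"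
      unfolding t(3) proj_diff sa_def[symmetric] using pos by simp
    also have "t *\<^sub>R (proj_map w c b - w) = (u / sx) *\<^sub>R (b - w)"
      unfolding t_def proj_diff sb_def[symmetric] using pos by simp
    also have "w + ((1 - u) / sx) *\<^sub>R (a - w) + (u / sx) *\<^sub>R (b - w) = w + (1 / sx) *\<^sub>R ((1 - u) *\<^sub>R (a - w) + u *\<^sub>R (b - w))"
      by (simp add: scaleR_add_right)
    also have "(1 - u) *\<^sub>R (a - w) + u *\<^sub>R (b - w) = x - w" by (simp add: u(3) algebra_simps)
    finally show ?thesis by (simp add: proj_map_def sx_def)
  qed
  moreover have "proj_map w c a \<noteq> proj_map w c b" using proj_inverse[OF a] proj_inverse[OF b] u(4) by metis
  ultimately show "proj_map w c x \<in> open_segment (proj_map w c a) (proj_map w c b)"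
    unfolding in_segment using t by blast
qed

lemma proj_closed_segment:
  assumes "c \<bullet> (a - w) < 1" "c \<bullet> (b - w) < 1" "x \<in> closed_segment a b"
  shows "proj_map w c x \<in> closed_segment (proj_map w c a) (proj_map w c b)"
  using assms proj_open_segment(2)[OF assms(1,2), of x] by (auto simp: closed_segment_eq_open)

lemma small_scale_below:
  fixes c m z w :: "'a::euclidean_space"
  assumes "c \<bullet> (m - w) < 1"
  obtains e where "0 < e" "e \<le> 1" "c \<bullet> (m + e *\<^sub>R z - w) < 1" "c \<bullet> (m - e *\<^sub>R z - w) < 1"
proof -
  define k where "k = 1 - c \<bullet> (m - w)"
  define e where "e = min 1 (k / (2 * (\<bar>c \<bullet> z\<bar> + 1)))"
  have k: "k > 0" using assms by (simp add: k_def)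
  then have e: "0 < e" "e \<le> 1" by (auto simp: e_def intro!: divide_pos_pos)
  have "e \<le> k / (2 * (\<bar>c \<bullet> z\<bar> + 1))" by (simp add: e_def)
  then have "e * (2 * (\<bar>c \<bullet> z\<bar> + 1)) \<le> k" by (simp add: pos_le_divide_eq)
  then have "2 * \<bar>e * (c \<bullet> z)\<bar> + 2 * e \<le> k" using e by (simp add: abs_mult algebra_simps)
  then have "\<bar>e * (c \<bullet> z)\<bar> < k" using e by linarith
  then have "c \<bullet> (m + e *\<^sub>R z - w) < 1" "c \<bullet> (m - e *\<^sub>R z - w) < 1"
    by (auto simp: k_def inner_diff_right inner_add_right abs_less_iff)
  then show ?thesis using that e by blast
qed

text \<open>
  Sending the hyperplane \<open>c \<bullet> (x - w) = 1\<close> to infinity creates no facet, since \<open>c\<close> is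
  bounded below on the polyhedron and hence nonnegative on its recession cone.
\<close>

lemma projective_image:
  fixes P :: "'a::euclidean_space set"
  assumes fr: "full_rep A N P" and w: "w \<in> P" and bd: "\<And>x. x \<in> P \<Longrightarrow> - M \<le> c \<bullet> (x - w)"
  obtains N' Q where "full_rep A N' Q" "card N' \<le> card N"
    "\<And>x. x \<in> poly_vertices P \<Longrightarrow> c \<bullet> (x - w) < 1 \<Longrightarrow> proj_map w c x \<in> poly_vertices Q"
    "\<And>y y'. poly_adj Q y y' \<Longrightarrow> poly_adj P (proj_map w (- c) y) (proj_map w (- c) y')"
    "\<And>y. y \<in> Q \<Longrightarrow> c \<bullet> (proj_map w (- c) y - w) < 1"
proof -
  define \<beta> where "\<beta> h = snd h - fst h \<bullet> w" for h :: "'a \<times> real"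
  \<comment> \<open>The inequality of \<open>h\<close>, centred at \<open>w\<close> with slack
    \<open>\<beta> h\<close>, after substituting the inverse map and multiplying by its denominator
    \<open>1 + c \<bullet> (y - w)\<close>.\<close>
  define tr where "tr h = (fst h - \<beta> h *\<^sub>R c, \<beta> h + (fst h - \<beta> h *\<^sub>R c) \<bullet> w)" for h
  define N' where "N' = tr ` N"
  define Q where "Q = A \<inter> hpoly N'"
  have A: "affine A" and fN: "finite N" using full_repD[OF fr] by auto
  have wA: "w \<in> A" using w full_repD(3)[OF fr] by blast
  have \<beta>0: "\<beta> h \<ge> 0" if "h \<in> N" for h using full_rep_in[OF fr, of w] w that by (simp add: \<beta>_def)
  have tr_le: "fst (tr h) \<bullet> y \<le> snd (tr h) \<longleftrightarrow> fst h \<bullet> (y - w) \<le> \<beta> h * (1 - (- c) \<bullet> (y - w))" for h y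
    by (simp add: tr_def inner_diff_left inner_diff_right algebra_simps)
  have tr_less: "fst (tr h) \<bullet> y < snd (tr h) \<longleftrightarrow> fst h \<bullet> (y - w) < \<beta> h * (1 - (- c) \<bullet> (y - w))" for h y
    by (simp add: tr_def inner_diff_left inner_diff_right algebra_simps)
  have Qmem: "y \<in> Q \<longleftrightarrow> y \<in> A \<and> (\<forall>h\<in>N. fst h \<bullet> (y - w) \<le> \<beta> h * (1 - (- c) \<bullet> (y - w)))" for y
    unfolding Q_def hpoly_def N'_def by (simp add: tr_le)
  have Pmem: "x \<in> P \<longleftrightarrow> x \<in> A \<and> (\<forall>h\<in>N. fst h \<bullet> (x - w) \<le> \<beta> h)" for x
    by (simp add: full_rep_in[OF fr] \<beta>_def inner_diff_right)
  have ray: "w + k *\<^sub>R (x - w) \<in> A" if "x \<in> A" for x k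
    using mem_affine[OF A wA that, of "1 - k" k] by (simp add: algebra_simps)
  have projA: "proj_map w d x \<in> A" if "x \<in> A" for d x
    unfolding proj_map_def using ray[OF that] .
  have toQ: "proj_map w c x \<in> Q" if "x \<in> P" "c \<bullet> (x - w) < 1" for x
  proof -
    have "fst h \<bullet> (proj_map w c x - w) \<le> \<beta> h * (1 - (- c) \<bullet> (proj_map w c x - w))" if h: "h \<in> N" for h
    proof -
      have "fst h \<bullet> (x - w) \<le> \<beta> h" using \<open>x \<in> P\<close> h Pmem by blast
      then show ?thesis unfolding proj_denominator[OF \<open>c \<bullet> (x - w) < 1\<close>] unfolding proj_diff
        using \<open>c \<bullet> (x - w) < 1\<close> by (simp add: divide_right_mono)
    qed
    then show ?thesis using Qmem projA that Pmem by blast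
  qed
  \<comment> \<open>At a point \<open>y\<close> with nonpositive denominator, \<open>y - w\<close>
    would be a recession direction of \<open>P\<close> along which \<open>c\<close> falls at rate at
    least 1. Following it for length \<open>M + 1\<close> violates the lower bound
    \<open>bd\<close>.\<close>
  have Qdom: "(- c) \<bullet> (y - w) < 1" if "y \<in> Q" for y
  proof (rule ccontr)
    assume neg: "\<not> (- c) \<bullet> (y - w) < 1"
    have rec: "fst h \<bullet> (y - w) \<le> 0" if h: "h \<in> N" for h
    proof -
      have "fst h \<bullet> (y - w) \<le> \<beta> h * (1 - (- c) \<bullet> (y - w))" using \<open>y \<in> Q\<close> h Qmem by blast
      also have "\<dots> \<le> 0" using \<beta>0[OF h] neg by (intro mult_nonneg_nonpos) auto
      finally show ?thesis .
    qed
    have M: "M \<ge> 0" using bd[OF w] by simp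
    let ?x = "w + (M + 1) *\<^sub>R (y - w)"
    have "?x \<in> P"
      unfolding Pmem using ray that Qmem rec M \<beta>0 by (auto intro: order_trans[OF mult_nonneg_nonpos])
    then have "- M \<le> (M + 1) * (c \<bullet> (y - w))" using bd by fastforce
    also have "\<dots> \<le> (M + 1) * (- 1)" using neg M by (intro mult_left_mono) auto
    finally show False by simp
  qed
  have toP: "proj_map w (- c) y \<in> P" "c \<bullet> (proj_map w (- c) y - w) < 1" if "y \<in> Q" for y
  proof -
    have d: "(- c) \<bullet> (y - w) < 1" using Qdom[OF that] .
    show "c \<bullet> (proj_map w (- c) y - w) < 1" using proj_dom[OF d] by simp
    have "fst h \<bullet> (proj_map w (- c) y - w) \<le> \<beta> h" if h: "h \<in> N" for h
    proof -
      have "fst h \<bullet> (y - w) \<le> \<beta> h * (1 - (- c) \<bullet> (y - w))" using \<open>y \<in> Q\<close> h Qmem by blast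
      then show ?thesis unfolding proj_diff using d by (simp add: pos_divide_le_eq)
    qed
    then show "proj_map w (- c) y \<in> P" using Pmem projA that Qmem by blast
  qed
  have inv': "proj_map w c (proj_map w (- c) y) = y" if "y \<in> Q" for y
    using proj_inverse[OF Qdom[OF that]] by simp
  have frQ: "full_rep A N' Q"
    unfolding full_rep_def
  proof (intro conjI A)
    show "finite N'" using fN by (simp add: N'_def)
    show "Q = A \<inter> hpoly N'" by (simp add: Q_def)
    obtain x0 where x0: "x0 \<in> A" "\<And>h. h \<in> N \<Longrightarrow> fst h \<bullet> x0 < snd h" using fr unfolding full_rep_def by blast
    \<comment> \<open>The strict point \<open>x0\<close> may lie beyond the hyperplane. Shrinking it
      towards \<open>w\<close> brings it into the domain and preserves strictness, because
      \<open>w\<close> is feasible.\<close>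
    obtain e where e: "0 < e" "e \<le> 1" "c \<bullet> (w + e *\<^sub>R (x0 - w) - w) < 1"
      using small_scale_below[of c w w "x0 - w"] by auto
    let ?x = "w + e *\<^sub>R (x0 - w)"
    have "fst (tr h) \<bullet> proj_map w c ?x < snd (tr h)" if h: "h \<in> N" for h
    proof -
      have "fst h \<bullet> (x0 - w) < \<beta> h" using x0(2)[OF h] by (simp add: \<beta>_def inner_diff_right)
      then have "e * (fst h \<bullet> (x0 - w)) < e * \<beta> h" using e by simp
      also have "\<dots> \<le> \<beta> h" using \<beta>0[OF h] e by (simp add: mult_left_le_one_le)
      finally have *: "fst h \<bullet> (?x - w) < \<beta> h" by simp
      have pos: "1 - c \<bullet> (?x - w) > 0" using e(3) by simp
      show ?thesis
        unfolding tr_less proj_denominator[OF e(3)] unfolding proj_diff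
        using divide_strict_right_mono[OF * pos] by simp
    qed
    moreover have "proj_map w c ?x \<in> A" using projA ray x0(1) by blast
    ultimately show "\<exists>x\<in>A. \<forall>h\<in>N'. fst h \<bullet> x < snd h" unfolding N'_def by blast
  qed
  have cP: "convex P" and cQ: "convex Q" using full_rep_convex fr frQ by blast+
  have vert: "proj_map w c x \<in> poly_vertices Q" if x: "x \<in> poly_vertices P" and xd: "c \<bullet> (x - w) < 1" for x
    unfolding poly_vertices_def mem_Collect_eq extreme_point_of_def
  proof (intro conjI ballI notI)
    show "proj_map w c x \<in> Q" using toQ vertex_in x xd by blast
    fix p q assume pq: "p \<in> Q" "q \<in> Q" "proj_map w c x \<in> open_segment p q"
    have "proj_map w (- c) (proj_map w c x) \<in> open_segment (proj_map w (- c) p) (proj_map w (- c) q)"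
      using proj_open_segment(2)[OF Qdom[OF pq(1)] Qdom[OF pq(2)] pq(3)] .
    then show False using x toP(1)[OF pq(1)] toP(1)[OF pq(2)] proj_inverse[OF xd]
      by (simp add: poly_vertices_def extreme_point_of_def)
  qed
  \<comment> \<open>Perturbations may be shrunk until they stay in the half-space of the map, so
    extremality and edges can be tested there alone.\<close>
  have local: "\<exists>e>0. m + e *\<^sub>R z \<in> P \<and> m - e *\<^sub>R z \<in> P \<and> c \<bullet> (m + e *\<^sub>R z - w) < 1 \<and> c \<bullet> (m - e *\<^sub>R z - w) < 1"
    if m: "m \<in> P" "c \<bullet> (m - w) < 1" and z: "m + z \<in> P" "m - z \<in> P" for m z
  proof -
    obtain e where e: "0 < e" "e \<le> 1" "c \<bullet> (m + e *\<^sub>R z - w) < 1" "c \<bullet> (m - e *\<^sub>R z - w) < 1"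
      using small_scale_below[OF m(2)] by blast
    have "m + e *\<^sub>R z \<in> P" using convex_mem_between[OF cP m(1), of 1 z e] z e by simp
    moreover have "m - e *\<^sub>R z \<in> P" using convex_mem_between[OF cP m(1), of 1 "- z" e] z e by simp
    ultimately show ?thesis using e by blast
  qed
  have vert': "proj_map w (- c) y \<in> poly_vertices P" if y: "y \<in> poly_vertices Q" for y
  proof -
    have yQ: "y \<in> Q" using vertex_in[OF y] .
    let ?x = "proj_map w (- c) y"
    have "z = 0" if z: "?x + z \<in> P" "?x - z \<in> P" for z
    proof (rule ccontr)
      assume "z \<noteq> 0"
      obtain e where e: "e > 0" "?x + e *\<^sub>R z \<in> P" "?x - e *\<^sub>R z \<in> P"
        "c \<bullet> (?x + e *\<^sub>R z - w) < 1" "c \<bullet> (?x - e *\<^sub>R z - w) < 1"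
        using local[OF toP[OF yQ] z] by blast
      have "?x \<in> open_segment (?x - e *\<^sub>R z) (?x + e *\<^sub>R z)"
        using \<open>z \<noteq> 0\<close> e(1) by (intro mid_in_open_segment) simp
      then have "proj_map w c ?x \<in> open_segment (proj_map w c (?x - e *\<^sub>R z)) (proj_map w c (?x + e *\<^sub>R z))"
        using proj_open_segment(2) e by blast
      then show False using y toQ e inv'[OF yQ] by (auto simp: poly_vertices_def extreme_point_of_def)
    qed
    then show ?thesis using toP(1)[OF yQ] by (simp add: poly_vertices_def extreme_iff_mid[OF cP])
  qed
  have adj: "poly_adj P (proj_map w (- c) y) (proj_map w (- c) y')" if yy: "poly_adj Q y y'" for y y'
  proof -
    have yv: "y \<in> poly_vertices Q" "y' \<in> poly_vertices Q" "y \<noteq> y'" using yy by (auto simp: poly_adj_def)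
    have yQ: "y \<in> Q" "y' \<in> Q" using yv vertex_in by blast+
    let ?x = "proj_map w (- c) y" and ?x' = "proj_map w (- c) y'"
    let ?m = "midpoint ?x ?x'"
    have ne: "?x \<noteq> ?x'" using inv' yQ yv(3) by metis
    have mo: "?m \<in> open_segment ?x ?x'" using ne by simp
    have mP: "?m \<in> P"
      using mo closed_segment_subset[OF toP(1)[OF yQ(1)] toP(1)[OF yQ(2)] cP] open_closed_segment by blast
    have md: "c \<bullet> (?m - w) < 1" using proj_open_segment(1)[OF toP(2)[OF yQ(1)] toP(2)[OF yQ(2)] mo] .
    have "proj_map w c ?m \<in> open_segment (proj_map w c ?x) (proj_map w c ?x')"
      using proj_open_segment(2)[OF toP(2)[OF yQ(1)] toP(2)[OF yQ(2)] mo] .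
    then have mseg: "proj_map w c ?m \<in> closed_segment y y'" using inv' yQ open_closed_segment by simp
    have "z \<in> span {?x' - ?x}" if z: "?m + z \<in> P" "?m - z \<in> P" for z
    proof (cases "z = 0")
      case False
      obtain e where e: "e > 0" "?m + e *\<^sub>R z \<in> P" "?m - e *\<^sub>R z \<in> P"
        "c \<bullet> (?m + e *\<^sub>R z - w) < 1" "c \<bullet> (?m - e *\<^sub>R z - w) < 1"
        using local[OF mP md z] by blast
      have "?m \<in> open_segment (?m - e *\<^sub>R z) (?m + e *\<^sub>R z)"
        using False e(1) by (intro mid_in_open_segment) simp
      then have os: "proj_map w c ?m \<in> open_segment (proj_map w c (?m - e *\<^sub>R z)) (proj_map w c (?m + e *\<^sub>R z))"
        using proj_open_segment(2) e by blast
      have "closed_segment y y' face_of Q" using yy by (simp add: poly_adj_def edge_of_def)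
      then have "proj_map w c (?m + e *\<^sub>R z) \<in> closed_segment y y'"
        using face_ofD[OF _ os toQ[OF e(3,5)] toQ[OF e(2,4)] mseg] by blast
      then have "proj_map w (- c) (proj_map w c (?m + e *\<^sub>R z)) \<in> closed_segment ?x ?x'"
        by (rule proj_closed_segment[OF Qdom[OF yQ(1)] Qdom[OF yQ(2)]])
      then have "?m + e *\<^sub>R z \<in> closed_segment ?x ?x'" by (simp only: proj_inverse[OF e(4)])
      then have "e *\<^sub>R z \<in> span {?x' - ?x}" by (rule segment_mid_span)
      then have "(1/e) *\<^sub>R (e *\<^sub>R z) \<in> span {?x' - ?x}" by (rule span_mul)
      then show ?thesis using e(1) by simp
    qed (simp add: span_zero)
    then show ?thesis unfolding adj_iff_mid[OF cP] using vert' yv ne by blast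
  qed
  show ?thesis
    by (rule that[OF frQ _ vert adj toP(2)]) (simp_all add: N'_def card_image_le fN)
qed

text \<open>The functional \<open>- g\<close> has its minimum at \<open>u\<close> and grows at rate
  \<open>\<kappa>\<close> away from it. If it nowhere exceeds its value at \<open>v\<close>, then
  \<open>P\<close> is bounded; having dimension at least 2, it has a third vertex \<open>q\<close>,
  and a functional exposing \<open>q\<close> is bounded below by compactness.\<close>

lemma separating_functional:
  fixes P :: "'a::euclidean_space set"
  assumes S: "finite S" "P = hpoly S" and dim: "2 \<le> aff_dim P"
    and uv: "u \<in> poly_vertices P" "v \<in> poly_vertices P" "u \<noteq> v"
  obtains c M q where "\<And>x. x \<in> P \<Longrightarrow> M \<le> c \<bullet> x" "q \<in> P" "c \<bullet> u < c \<bullet> q" "c \<bullet> v < c \<bullet> q"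
proof -
  obtain g \<kappa> where \<kappa>: "\<kappa> > 0" and g: "\<And>z. z \<in> hpoly S \<Longrightarrow> g \<bullet> z \<le> g \<bullet> u - \<kappa> * norm (z - u)"
    using vertex_exposed[OF S(1), of u] uv(1) S(2) by metis
  have g': "\<kappa> * norm (z - u) \<le> (- g) \<bullet> z - (- g) \<bullet> u" if "z \<in> P" for z using g[of z] that S(2) by simp
  have lower: "(- g) \<bullet> u \<le> (- g) \<bullet> z" if "z \<in> P" for z
  proof -
    have "0 \<le> \<kappa> * norm (z - u)" using \<kappa> by simp
    then show ?thesis using g'[OF that] by linarith
  qed
  have vP: "v \<in> P" using vertex_in[OF uv(2)] .
  show ?thesis
  proof (cases "\<exists>q\<in>P. (- g) \<bullet> v < (- g) \<bullet> q")
    case True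
    then obtain q where q: "q \<in> P" "(- g) \<bullet> v < (- g) \<bullet> q" by blast
    have "(- g) \<bullet> u < (- g) \<bullet> q" using lower[OF vP] q(2) by linarith
    then show ?thesis using that[of "(- g) \<bullet> u" "- g" q] lower q by blast
  next
    case False
    define R where "R = ((- g) \<bullet> v - (- g) \<bullet> u) / \<kappa>"
    have dist: "norm (z - u) \<le> R" if "z \<in> P" for z
    proof -
      have "(- g) \<bullet> z \<le> (- g) \<bullet> v" using False that by (auto simp: not_less)
      then have "\<kappa> * norm (z - u) \<le> (- g) \<bullet> v - (- g) \<bullet> u" using g'[OF that] by linarith
      then show ?thesis using \<kappa> by (simp add: R_def pos_le_divide_eq mult.commute)
    qed
    have "bounded P"
    proof (rule boundedI[of _ "norm u + R"])
      fix z assume "z \<in> P"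
      then show "norm z \<le> norm u + R" using dist[of z] norm_triangle_sub[of z u] by linarith
    qed
    then have "compact P" using S by (simp add: compact_eq_bounded_closed closed_hpoly)
    then have KM: "P = convex hull (poly_vertices P)"
      unfolding poly_vertices_def using S by (intro Krein_Milman_Minkowski) (auto simp: convex_hpoly)
    have "\<not> poly_vertices P \<subseteq> {u, v}"
    proof
      assume "poly_vertices P \<subseteq> {u, v}"
      then have "aff_dim (poly_vertices P) \<le> aff_dim {u, v}" by (rule aff_dim_subset)
      moreover have "aff_dim P = aff_dim (poly_vertices P)" using KM aff_dim_convex_hull by metis
      ultimately show False using dim by (simp add: aff_dim_2 split: if_splits)
    qed
    then obtain q where q: "q \<in> poly_vertices P" "q \<noteq> u" "q \<noteq> v" by blast
    obtain c \<kappa>' where \<kappa>': "\<kappa>' > 0" and c: "\<And>z. z \<in> hpoly S \<Longrightarrow> c \<bullet> z \<le> c \<bullet> q - \<kappa>' * norm (z - q)"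
      using vertex_exposed[OF S(1), of q] q(1) S(2) by metis
    have less: "c \<bullet> z < c \<bullet> q" if "z \<in> P" "z \<noteq> q" for z
    proof -
      have "0 < \<kappa>' * norm (z - q)" using \<kappa>' that(2) by simp
      then show ?thesis using c[of z] that(1) S(2) by simp
    qed
    have "c \<bullet> u - norm c * R \<le> c \<bullet> z" if "z \<in> P" for z
    proof -
      have "\<bar>c \<bullet> (z - u)\<bar> \<le> norm c * norm (z - u)" by (rule Cauchy_Schwarz_ineq2)
      also have "\<dots> \<le> norm c * R" using dist[OF that] by (simp add: mult_left_mono)
      finally show ?thesis by (simp add: inner_diff_right)
    qed
    then show ?thesis using that[of _ c q] vertex_in[OF q(1)] less[OF vertex_in[OF uv(1)]] less[OF vP] q by blast
  qed
qed

text \<open>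
  Truncate \<open>v\<close> and send to infinity a hyperplane crossing an edge at \<open>v\<close> on which \<open>c\<close> increases.
  The new vertex on this edge keeps only neighbours that are new vertices, all at distance at least
  that of \<open>v\<close>, so it is one step further away.
\<close>

lemma increase_dist_directed:
  fixes P :: "'a::euclidean_space set"
  assumes P: "polyhedron P" "2 \<le> aff_dim P" and uv: "u \<in> poly_vertices P" "v \<in> poly_vertices P" "u \<noteq> v"
    and bd: "\<And>x. x \<in> P \<Longrightarrow> M \<le> c \<bullet> x" and cuv: "c \<bullet> u \<le> c \<bullet> v" and q: "q \<in> P" "c \<bullet> v < c \<bullet> q"
  obtains Q :: "'a set" and u' v' where "polyhedron Q" "aff_dim Q = aff_dim P"
    "card (facets Q) \<le> Suc (card (facets P))" "u' \<in> poly_vertices Q" "v' \<in> poly_vertices Q"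
    "graph_dist P u v + 1 \<le> graph_dist Q u' v'"
proof -
  have "P \<noteq> {}" using vertex_in[OF uv(1)] by blast
  then obtain N where N: "full_rep (affine hull P) N P" "irredundant (affine hull P) N" using polyhedron_full_rep[OF P(1)] by blast
  let ?A = "affine hull P"
  obtain E where E: "affine_rep E ?A" "finite (E \<union> N)" "P = hpoly (E \<union> N)" using full_rep_hpoly[OF N(1)] by metis
  have vS: "v \<in> poly_vertices (hpoly (E \<union> N))" using uv(2) E(3) by simp
  obtain r where r: "edge_dir (E \<union> N) v r" and cr: "c \<bullet> r > 0"
    using improving_edge_dir[OF E(2) vS, of q c] q E(3) by metis
  \<comment> \<open>The level of \<open>c\<close> to be sent to infinity. It must be reached on the
    edge along \<open>r\<close> no later than at its other end; on an unbounded edge any level above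
    \<open>c \<bullet> v\<close> serves.\<close>
  obtain \<tau> where \<tau>: "c \<bullet> v < \<tau>"
    and end_edge: "\<And>s. s > 0 \<Longrightarrow> v + s *\<^sub>R r \<in> poly_vertices P \<Longrightarrow> \<tau> \<le> c \<bullet> v + s * (c \<bullet> r)"
  proof (cases "\<forall>t\<ge>0. v + t *\<^sub>R r \<in> hpoly (E \<union> N)")
    case True
    have False if s: "s > 0" "v + s *\<^sub>R r \<in> poly_vertices P" for s
    proof -
      have "v + s *\<^sub>R r \<in> open_segment (v + s *\<^sub>R r - s *\<^sub>R r) (v + s *\<^sub>R r + s *\<^sub>R r)"
        using s r by (intro mid_in_open_segment) (simp add: edge_dir_def)
      moreover have "v + s *\<^sub>R r + s *\<^sub>R r = v + (2 * s) *\<^sub>R r" by (simp add: scaleR_2 flip: scaleR_scaleR)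
      moreover have "v + (2 * s) *\<^sub>R r \<in> P" using True s E(3) by simp
      ultimately show False using s(2) vertex_in[OF uv(2)] by (auto simp: poly_vertices_def extreme_point_of_def)
    qed
    then show ?thesis using that[of "c \<bullet> v + 1"] by auto
  next
    case False
    then obtain t where t: "t > 0" "poly_adj (hpoly (E \<union> N)) v (v + t *\<^sub>R r)"
      using edge_ends[OF E(2) vS r] by metis
    have "t \<le> s" if s: "s > 0" "v + s *\<^sub>R r \<in> poly_vertices P" for s
    proof (rule ccontr)
      assume "\<not> t \<le> s"
      have ext: "v extreme_point_of P" "v + s *\<^sub>R r extreme_point_of P" using uv(2) s by (auto simp: poly_vertices_def)
      have "v \<noteq> v + s *\<^sub>R r" using s r by (simp add: edge_dir_def)
      moreover have "v + (t / s) *\<^sub>R (v + s *\<^sub>R r - v) \<in> P"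
        using poly_adj_vertices[OF t(2)] vertex_in[of "v + t *\<^sub>R r" P] E(3) s(1) by simp
      ultimately have "t / s \<le> 1" using mem_line_between_extreme[OF ext] by blast
      then show False using \<open>\<not> t \<le> s\<close> s(1) by (simp add: pos_divide_le_eq)
    qed
    then show ?thesis using that[of "c \<bullet> v + t * (c \<bullet> r)"] t(1) cr by simp
  qed
  \<comment> \<open>The parameter at which the edge reaches level \<open>\<tau>\<close>. Truncating
    before it keeps the new vertex on the finite side.\<close>
  define \<eta> where "\<eta> = (\<tau> - c \<bullet> v) / (c \<bullet> r)"
  have \<eta>: "\<eta> > 0" using \<tau> cr by (simp add: \<eta>_def)
  obtain g b \<delta> where \<delta>: "0 < \<delta>" "\<delta> < \<eta>" and
    T: "(g, b) \<notin> N" "full_rep ?A (insert (g, b) N) (P \<inter> {x. g \<bullet> x \<le> b})"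
    "irredundant ?A (insert (g, b) N)"
    "v + \<delta> *\<^sub>R r \<in> poly_vertices (P \<inter> {x. g \<bullet> x \<le> b})" "g \<bullet> (v + \<delta> *\<^sub>R r) = b"
    "\<And>x. x \<in> poly_vertices P \<Longrightarrow> x \<noteq> v \<Longrightarrow> x \<in> poly_vertices (P \<inter> {x. g \<bullet> x \<le> b}) \<and> g \<bullet> x < b"
    "\<And>x y. poly_adj (P \<inter> {x. g \<bullet> x \<le> b}) x y \<Longrightarrow> g \<bullet> x < b \<Longrightarrow> g \<bullet> y < b \<Longrightarrow> poly_adj P x y"
    "\<And>x y. poly_adj (P \<inter> {x. g \<bullet> x \<le> b}) x y \<Longrightarrow> g \<bullet> x < b \<Longrightarrow> g \<bullet> y = b \<Longrightarrow>
       poly_adj P x v \<and> y \<in> open_segment v x"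
    by (rule truncate_vertex[OF N P(2) E(1) uv(2) r \<eta>]) (rule that)
  let ?P = "P \<inter> {x. g \<bullet> x \<le> b}" and ?p = "v + \<delta> *\<^sub>R r"
  let ?d = "vdist P u"
  have u': "u \<in> poly_vertices ?P" "g \<bullet> u < b" using T(6)[OF uv(1,3)] by auto
  have p\<tau>: "c \<bullet> ?p < \<tau>"
    using \<delta>(2) cr by (simp add: \<eta>_def inner_add_right pos_less_divide_eq algebra_simps)
  have u\<tau>: "c \<bullet> u < \<tau>" using cuv \<tau> by linarith
  \<comment> \<open>A neighbour of \<open>?p\<close> strictly below the cut can only be the far end
    of the edge along \<open>r\<close>, which is not on the finite side.\<close>
  have isolated: "\<tau> \<le> c \<bullet> x" if x: "poly_adj ?P x ?p" "g \<bullet> x < b" for x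
  proof -
    have a: "poly_adj P x v" "?p \<in> open_segment v x" using T(8)[OF x(1,2) T(5)] by auto
    obtain k where k: "0 < k" "?p = (1 - k) *\<^sub>R v + k *\<^sub>R x" using a(2) by (auto simp: in_segment)
    then have "k *\<^sub>R (x - v) = \<delta> *\<^sub>R r" by (simp add: algebra_simps)
    then have "(1/k) *\<^sub>R (k *\<^sub>R (x - v)) = (1/k) *\<^sub>R (\<delta> *\<^sub>R r)" by simp
    then have xv: "x = v + (\<delta> / k) *\<^sub>R r" using k(1) by (simp add: algebra_simps)
    have "\<tau> \<le> c \<bullet> v + (\<delta> / k) * (c \<bullet> r)"
      using end_edge[of "\<delta> / k"] xv poly_adj_vertices[OF a(1)] \<delta>(1) k(1) by simp
    then show ?thesis by (simp add: xv inner_add_right)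
  qed
  \<comment> \<open>Normalised so that, relative to the fixed point \<open>u\<close>, the value 1
    corresponds to level \<open>\<tau>\<close>; this is possible because
    \<open>c \<bullet> u < \<tau>\<close>.\<close>
  define c' where "c' = (1 / (\<tau> - c \<bullet> u)) *\<^sub>R c"
  have c': "c' \<bullet> (x - u) < 1 \<longleftrightarrow> c \<bullet> x < \<tau>" for x
  proof -
    have "c' \<bullet> (x - u) = (c \<bullet> x - c \<bullet> u) / (\<tau> - c \<bullet> u)"
      by (simp add: c'_def inner_diff_right diff_divide_distrib)
    then show ?thesis using u\<tau> by (simp add: pos_divide_less_eq del: inner_diff_right)
  qed
  have bd': "- ((c \<bullet> u - M) / (\<tau> - c \<bullet> u)) \<le> c' \<bullet> (x - u)" if "x \<in> ?P" for x
  proof -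
    have "M - c \<bullet> u \<le> c \<bullet> x - c \<bullet> u" using bd that by simp
    then have "(M - c \<bullet> u) / (\<tau> - c \<bullet> u) \<le> (c \<bullet> x - c \<bullet> u) / (\<tau> - c \<bullet> u)"
      using u\<tau> by (intro divide_right_mono) auto
    then show ?thesis by (simp add: c'_def inner_diff_right minus_divide_left diff_divide_distrib)
  qed
  obtain N' Q where Q: "full_rep ?A N' Q" "card N' \<le> card (insert (g, b) N)"
    "\<And>x. x \<in> poly_vertices ?P \<Longrightarrow> c' \<bullet> (x - u) < 1 \<Longrightarrow> proj_map u c' x \<in> poly_vertices Q"
    "\<And>y y'. poly_adj Q y y' \<Longrightarrow> poly_adj ?P (proj_map u (- c') y) (proj_map u (- c') y')"
    "\<And>y. y \<in> Q \<Longrightarrow> c' \<bullet> (proj_map u (- c') y - u) < 1"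
    by (rule projective_image[OF T(2) vertex_in[OF u'(1)] bd']) (assumption, rule that)
  \<comment> \<open>Only growth along an edge is restricted. The extra unit at \<open>?p\<close> is
    thus critical only when arriving from an old vertex, which \<open>isolated\<close> rules
    out.\<close>
  define f where "f x = (if g \<bullet> x < b then ?d x else if x = ?p then Suc (?d v) else ?d v)" for x
  have "enat ((f \<circ> proj_map u (- c')) (proj_map u c' ?p)) \<le> graph_dist Q (proj_map u c' u) (proj_map u c' ?p)"
  proof (rule graph_dist_ge_potential)
    show "(f \<circ> proj_map u (- c')) (proj_map u c' u) = 0" using u' by (simp add: proj_self f_def vdist_self)
    fix y y' assume yy: "poly_adj Q y y'"
    have \<tau>y: "c \<bullet> proj_map u (- c') y < \<tau>" "c \<bullet> proj_map u (- c') y' < \<tau>"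
      using Q(5) vertex_in poly_adj_vertices[OF yy] c' by blast+
    have "f q \<le> Suc (f p)" if pq: "poly_adj ?P p q" and \<tau>p: "c \<bullet> p < \<tau>" for p q
    proof -
      have qp: "poly_adj ?P q p" using pq by (rule poly_adj_sym)
      have "p \<in> ?P" "q \<in> ?P" using poly_adj_vertices[OF pq] vertex_in by blast+
      then have le: "g \<bullet> p \<le> b" "g \<bullet> q \<le> b" by auto
      show ?thesis
      proof (cases "g \<bullet> p < b"; cases "g \<bullet> q < b")
        assume "g \<bullet> p < b" "g \<bullet> q < b"
        then show ?thesis using vdist_step[OF P(1) uv(1) T(7)[OF pq]] by (simp add: f_def)
      next
        assume *: "g \<bullet> p < b" "\<not> g \<bullet> q < b"
        then have "poly_adj P p v" using T(8)[OF pq] le by auto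
        moreover have "q \<noteq> ?p" using isolated[of p] pq * \<tau>p by auto
        ultimately show ?thesis using vdist_step[OF P(1) uv(1), of p v] * by (simp add: f_def)
      next
        assume *: "\<not> g \<bullet> p < b" "g \<bullet> q < b"
        then have "poly_adj P q v" using T(8)[OF qp] le by auto
        then have "poly_adj P v q" by (rule poly_adj_sym)
        then show ?thesis using vdist_step[OF P(1) uv(1), of v q] * by (simp add: f_def)
      qed (simp add: f_def)
    qed
    then show "(f \<circ> proj_map u (- c')) y' \<le> Suc ((f \<circ> proj_map u (- c')) y)" using Q(4)[OF yy] \<tau>y by simp
  qed
  moreover have "(f \<circ> proj_map u (- c')) (proj_map u c' ?p) = Suc (?d v)"
    using proj_inverse[of c' ?p u] c' p\<tau> T(5) unfolding f_def by simp
  ultimately have "enat (Suc (?d v)) \<le> graph_dist Q (proj_map u c' u) (proj_map u c' ?p)" by simp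
  then have "graph_dist P u v + 1 \<le> graph_dist Q (proj_map u c' u) (proj_map u c' ?p)"
    unfolding vdist(1)[OF P(1) uv(1,2)] by (simp add: one_enat_def)
  moreover have "card (facets Q) \<le> Suc (card (facets P))"
    using card_facets_le[OF Q(1)] Q(2) card_facets_eq[OF N] T(1) full_repD(2)[OF N(1)] by simp
  moreover have "aff_dim Q = aff_dim P" using full_rep_aff_dim[OF Q(1)] by simp
  moreover have "proj_map u c' u \<in> poly_vertices Q" "proj_map u c' ?p \<in> poly_vertices Q"
    using Q(3) u'(1) T(4) c' u\<tau> p\<tau> by blast+
  ultimately show ?thesis using that full_rep_polyhedron[OF Q(1)] by blast
qed

lemma increase_dist:
  fixes P :: "'a::euclidean_space set"
  assumes P: "polyhedron P" "2 \<le> aff_dim P" and uv: "u \<in> poly_vertices P" "v \<in> poly_vertices P" "u \<noteq> v"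
  obtains Q :: "'a set" and u' v' where "polyhedron Q" "aff_dim Q = aff_dim P"
    "card (facets Q) \<le> Suc (card (facets P))" "u' \<in> poly_vertices Q" "v' \<in> poly_vertices Q"
    "graph_dist P u v + 1 \<le> graph_dist Q u' v'"
proof -
  have "P \<noteq> {}" using vertex_in[OF uv(1)] by blast
  then obtain N where "full_rep (affine hull P) N P" using polyhedron_full_rep[OF P(1)] by blast
  then obtain E where E: "finite (E \<union> N)" "P = hpoly (E \<union> N)" using full_rep_hpoly by metis
  obtain c M q where c: "\<And>x. x \<in> P \<Longrightarrow> M \<le> c \<bullet> x" "q \<in> P" "c \<bullet> u < c \<bullet> q" "c \<bullet> v < c \<bullet> q"
    by (rule separating_functional[OF E P(2) uv]) (rule that)
  show ?thesis
  \<comment> \<open>The vertex with the larger value of \<open>c\<close> is truncated, so that the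
    other one stays on the finite side of the hyperplane.\<close>
  proof (cases "c \<bullet> u \<le> c \<bullet> v")
    case True
    show ?thesis by (rule increase_dist_directed[OF P uv c(1) True c(2,4)]) (assumption, rule that)
  next
    case False
    then have vu: "c \<bullet> v \<le> c \<bullet> u" by simp
    show ?thesis
      by (rule increase_dist_directed[OF P uv(2,1) uv(3)[symmetric] c(1) vu c(2,3)])
         (assumption, rule that, simp_all add: graph_dist_commute)
  qed
qed

lemma graph_dist_less_Delta:
  fixes P :: "'a::euclidean_space set"
  assumes P: "polyhedron P" "aff_dim P = int m" "2 \<le> m" and uv: "u \<in> poly_vertices P" "v \<in> poly_vertices P"
    and n: "card (facets P) < n"
  shows "graph_dist P u v + 1 \<le> Delta_u TYPE('a) m n"
proof (cases "u = v")
  \<comment> \<open>\<open>increase_dist\<close> needs distinct vertices. Here the distance is 0,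
    and since a vertex forces at least \<open>m\<close> facets, \<open>n\<close> is large enough for
    a padded simplex with distance at least 1.\<close>
  case True
  have "P \<noteq> {}" using vertex_in[OF uv(1)] by blast
  then obtain N where N: "full_rep (affine hull P) N P" "irredundant (affine hull P) N" using polyhedron_full_rep[OF P(1)] by blast
  have "int m \<le> int (card (active N u))" using vertex_card_active[OF N(1) uv(1)] P(2) by simp
  also have "card (active N u) \<le> card N" using full_repD(2)[OF N(1)] active_subset by (intro card_mono)
  finally have "Suc m \<le> n" using card_facets_eq[OF N] n by simp
  have "m \<le> DIM('a)" using aff_dim_le_DIM[of P] P(2) by simp
  then obtain Q :: "'a set" and x y where Q: "polyhedron Q" "aff_dim Q = int m" "card (facets Q) = Suc m"
    "x \<in> poly_vertices Q" "y \<in> poly_vertices Q" "x \<noteq> y"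
    using simplex_polyhedron[of m] P(3) by (metis le_trans one_le_numeral)
  have "graph_dist Q x y \<le> Delta_u TYPE('a) m n"
    using graph_dist_le_Delta[OF Q(1,2) P(3) Q(4-6)] Q(3) \<open>Suc m \<le> n\<close> by simp
  moreover have "1 \<le> graph_dist Q x y" using graph_dist_pos[OF Q(6)] .
  moreover have "graph_dist P u v \<le> 0" using graph_dist_le[of 0 P u v] True by (simp add: zero_enat_def)
  ultimately show ?thesis by simp
next
  case False
  have "2 \<le> aff_dim P" using P by simp
  then obtain Q :: "'a set" and u' v' where Q: "polyhedron Q" "aff_dim Q = aff_dim P"
    "card (facets Q) \<le> Suc (card (facets P))" "u' \<in> poly_vertices Q" "v' \<in> poly_vertices Q"
    "graph_dist P u v + 1 \<le> graph_dist Q u' v'"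
    using increase_dist[OF P(1) _ uv False] by blast
  have "u' \<noteq> v'"
  proof
    assume "u' = v'"
    then have "graph_dist Q u' v' \<le> 0" using graph_dist_le[of 0 Q u' v'] by (simp add: zero_enat_def)
    then show False using Q(6) by simp
  qed
  then have "graph_dist Q u' v' \<le> Delta_u TYPE('a) m n"
    using graph_dist_le_Delta[OF Q(1) _ P(3) Q(4,5)] Q(2,3) P(2) n by simp
  then show ?thesis using Q(6) by (rule order_trans[rotated])
qed

section \<open>The recursion\<close>

lemma Delta_u_mono:
  assumes "2 \<le> m" "k \<le> n"
  shows "Delta_u TYPE('a::euclidean_space) m k \<le> Delta_u TYPE('a) m n"
proof (cases "k = n")
  case False
  have "graph_dist P u v \<le> Delta_u TYPE('a) m n"
    if "P \<in> polyhedra m k" "u \<in> poly_vertices P" "v \<in> poly_vertices P" for P :: "'a set" and u v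
  proof -
    have "graph_dist P u v + 1 \<le> Delta_u TYPE('a) m n"
      using that assms False by (intro graph_dist_less_Delta) (auto simp: polyhedra_def facets_def)
    moreover have "graph_dist P u v \<le> graph_dist P u v + 1" by (simp add: plus_1_eSuc ile_eSuc)
    ultimately show ?thesis by (rule order_trans[rotated])
  qed
  then show ?thesis unfolding Delta_u_def[of _ m k] graph_diameter_def by (intro SUP_least)
qed simp

lemma Delta_u_pos:
  assumes "2 \<le> m" "m < n" "m \<le> DIM('a::euclidean_space)"
  shows "1 \<le> Delta_u TYPE('a) m n"
proof -
  obtain Q :: "'a set" and x y where Q: "polyhedron Q" "aff_dim Q = int m" "card (facets Q) = Suc m"
    "x \<in> poly_vertices Q" "y \<in> poly_vertices Q" "x \<noteq> y"
    using simplex_polyhedron[of m] assms by (metis le_trans one_le_numeral)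
  have "graph_dist Q x y \<le> Delta_u TYPE('a) m n"
    using graph_dist_le_Delta[OF Q(1,2) assms(1) Q(4-6)] Q(3) assms(2) by simp
  then show ?thesis using graph_dist_pos[OF Q(6), of Q] by (rule order_trans[rotated])
qed

text \<open>The recursive bound for D. Its value 0 below \<open>d\<close> facets reflects that there
  are no vertices; the disjunct \<open>n = 0\<close> secures termination for
  \<open>d = 0\<close>.\<close>

fun dbound :: "'a::euclidean_space itself \<Rightarrow> nat \<Rightarrow> nat \<Rightarrow> enat" where
  "dbound T d n = (if n < d \<or> n = 0 then 0 else Delta_u T (d - 1) n + 2 * dbound T d (n div 2))"

declare dbound.simps [simp del]

text \<open>The relaxation in the recursion is only known to have at most \<open>n div 2\<close>
  facets.\<close>

lemma dbound_mono:
  assumes "3 \<le> d" "k \<le> n"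
  shows "dbound TYPE('a::euclidean_space) d k \<le> dbound TYPE('a) d n"
  using assms(2)
proof (induction n arbitrary: k rule: less_induct)
  case (less n)
  show ?case
  proof (cases "k < d \<or> k = 0")
    case True
    then show ?thesis by (simp add: dbound.simps[of _ d k])
  next
    case False
    then have n: "\<not> (n < d \<or> n = 0)" using less.prems by auto
    have "dbound TYPE('a) d (k div 2) \<le> dbound TYPE('a) d (n div 2)"
      using n less.prems by (intro less.IH) (auto simp: div_le_mono)
    then have "Delta_u TYPE('a) (d - 1) k + 2 * dbound TYPE('a) d (k div 2) \<le>
        Delta_u TYPE('a) (d - 1) n + 2 * dbound TYPE('a) d (n div 2)"
      using assms(1) by (intro add_mono mult_left_mono Delta_u_mono less.prems) auto
    then show ?thesis
      unfolding dbound.simps[of _ d k] dbound.simps[of _ d n] if_not_P[OF False] if_not_P[OF n] .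
  qed
qed

text \<open>
  An edge of the relaxation \<open>Q\<close> leaving a vertex close to \<open>v\<close> contains an edge of \<open>P\<close>, and cannot be
  longer than it because the far end of the latter is a vertex of \<open>Q\<close> as well.
\<close>

lemma path_in_relaxation:
  fixes P :: "'a::euclidean_space set"
  assumes fr: "full_rep A N P" and frQ: "full_rep A N' Q" and sub: "N' \<subseteq> N"
    and reach: "\<And>j y h. j \<le> k \<Longrightarrow> (poly_adj P ^^ j) v y \<Longrightarrow> y \<in> poly_vertices P \<Longrightarrow> h \<in> active N y \<Longrightarrow> h \<in> N'"
    and v: "v \<in> poly_vertices P"
  shows "j \<le> k \<Longrightarrow> (poly_adj P ^^ j) v y \<Longrightarrow> y \<in> poly_vertices P \<Longrightarrow> y \<in> poly_vertices Q"
    and "j \<le> k \<Longrightarrow> (poly_adj Q ^^ j) v y \<Longrightarrow> (poly_adj P ^^ j) v y \<and> y \<in> poly_vertices P"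
proof -
  obtain E where E: "affine_rep E A" using affine_rep_exists full_repD(1)[OF fr] by blast
  let ?S = "E \<union> N" and ?T = "E \<union> N'"
  have fS: "finite ?S" and fT: "finite ?T" using E full_repD(2)[OF fr] full_repD(2)[OF frQ] by (auto simp: affine_rep_def)
  have PS: "P = hpoly ?S" and QT: "Q = hpoly ?T"
    using E full_repD(3)[OF fr] full_repD(3)[OF frQ] by (auto simp: affine_rep_def hpoly_Un)
  have PQ: "P \<subseteq> Q" unfolding PS QT using sub by (intro hpoly_mono) auto
  have active_eq: "active ?T y = active ?S y" if "j \<le> k" "(poly_adj P ^^ j) v y" "y \<in> poly_vertices P" for j y
    using reach[OF that] sub by (auto simp: active_def)
  show inQ: "y \<in> poly_vertices Q" if y: "j \<le> k" "(poly_adj P ^^ j) v y" "y \<in> poly_vertices P" for j y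
    using y(3) active_eq[OF y] PQ unfolding QT vertex_iff[OF fT] unfolding PS vertex_iff[OF fS] by auto
  show "j \<le> k \<Longrightarrow> (poly_adj Q ^^ j) v y \<Longrightarrow> (poly_adj P ^^ j) v y \<and> y \<in> poly_vertices P"
  proof (induction j arbitrary: y)
    case 0
    then show ?case using v by simp
  next
    case (Suc j)
    then obtain x where x: "(poly_adj Q ^^ j) v x" "poly_adj Q x y" by auto
    then have IH: "(poly_adj P ^^ j) v x" "x \<in> poly_vertices P" using Suc by auto
    have xS: "x \<in> poly_vertices (hpoly ?S)" using IH(2) PS by simp
    have "edge_dir ?T x (y - x)" using adj_edge_dir[OF fT] x(2) QT by blast
    \<comment> \<open>Near \<open>v\<close> no active inequality was dropped, so \<open>P\<close>
      and \<open>Q\<close> have the same feasible directions at \<open>x\<close>.\<close>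
    then have dir: "edge_dir ?S x (y - x)" using active_eq[OF _ IH] Suc.prems(1) by (simp add: edge_dir_def)
    have ext: "x extreme_point_of Q" "y extreme_point_of Q" "x \<noteq> y"
      using x(2) by (auto simp: poly_adj_def poly_vertices_def)
    have bound: "s \<le> 1" if "x + s *\<^sub>R (y - x) \<in> Q" for s
      using mem_line_between_extreme[OF ext that] by blast
    have "\<not> (\<forall>t\<ge>0. x + t *\<^sub>R (y - x) \<in> hpoly ?S)"
      using bound[of 2] PQ PS by force
    then obtain t where t: "t > 0" "poly_adj (hpoly ?S) x (x + t *\<^sub>R (y - x))"
      using edge_ends[OF fS xS dir] by metis
    let ?z = "x + t *\<^sub>R (y - x)"
    have adj: "poly_adj P x ?z" using t(2) PS by simp
    have zv: "?z \<in> poly_vertices P" using poly_adj_vertices[OF adj] by blast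
    have reach_z: "(poly_adj P ^^ Suc j) v ?z" using relpowp_Suc_I[OF IH(1) adj] .
    have "?z \<in> poly_vertices Q" using inQ[OF Suc.prems(1) reach_z zv] .
    then have zext: "?z extreme_point_of Q" by (simp add: poly_vertices_def)
    have "x \<noteq> ?z" using adj by (simp add: poly_adj_def)
    moreover have "x + (1/t) *\<^sub>R (?z - x) \<in> Q" using t(1) ext(2) by (simp add: extreme_point_of_def)
    ultimately have "1 / t \<le> 1" using mem_line_between_extreme[OF ext(1) zext] by blast
    moreover have "t \<le> 1" using bound[of t] PQ vertex_in[OF zv] by blast
    ultimately have "t = 1" using t(1) by (simp add: field_simps)
    then show ?case using reach_z zv by simp
  qed
qed

text \<open>The induction keeps \<open>d\<close> fixed: relaxations lose facets but not dimension,
  and dimension \<open>d - 1\<close> enters only through \<open>Delta_u\<close>.\<close>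

lemma graph_dist_dbound:
  fixes P :: "'a::euclidean_space set"
  assumes d: "3 \<le> d"
  shows "polyhedron P \<Longrightarrow> aff_dim P = int d \<Longrightarrow> v \<in> poly_vertices P \<Longrightarrow> w \<in> poly_vertices P \<Longrightarrow>
    d \<le> card (facets P) \<and> graph_dist P v w + 1 \<le> dbound TYPE('a) d (card (facets P))"
proof (induction "card (facets P)" arbitrary: P v w rule: less_induct)
  case (less P)
  let ?n = "card (facets P)" and ?A = "affine hull P"
  have "P \<noteq> {}" using vertex_in[OF less.prems(3)] by blast
  then obtain N where N: "full_rep ?A N P" "irredundant ?A N" using polyhedron_full_rep[OF less.prems(1)] by blast
  have nN: "?n = card N" using card_facets_eq[OF N] .
  have fN: "finite N" using full_repD(2)[OF N(1)] .
  obtain E where E: "finite (E \<union> N)" "P = hpoly (E \<union> N)" using full_rep_hpoly[OF N(1)] by metis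
  have "int d \<le> int (card (active N v))" using vertex_card_active[OF N(1) less.prems(3)] less.prems(2) by simp
  also have "card (active N v) \<le> card N" using fN active_subset by (intro card_mono)
  finally have dn: "d \<le> ?n" using nN by simp
  \<comment> \<open>The inequalities met, that is active at some vertex, within \<open>k\<close>
    steps from \<open>v\<close>.\<close>
  define R where "R v k = {h \<in> N. \<exists>j y. j \<le> k \<and> (poly_adj P ^^ j) v y \<and> y \<in> poly_vertices P \<and> h \<in> active N y}" for v k
  have Rsub: "R v k \<subseteq> N" for v k by (auto simp: R_def)
  have finR: "finite (R v k)" for v k using Rsub fN finite_subset by blast
  have big: "\<exists>k. ?n div 2 < card (R v k) \<and> enat k \<le> dbound TYPE('a) d (?n div 2)"
    if v: "v \<in> poly_vertices P" for v
  proof -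
    \<comment> \<open>Every facet is eventually met: a simplex walk maximising its normal ends on
      it.\<close>
    have "\<exists>k. R v k = N"
    proof -
      have "\<exists>j y. (poly_adj P ^^ j) v y \<and> y \<in> poly_vertices P \<and> h \<in> active N y" if h: "h \<in> N" for h
      proof -
        have up: "\<And>z. z \<in> hpoly (E \<union> N) \<Longrightarrow> fst h \<bullet> z \<le> snd h" using hpolyD h by blast
        have vS: "v \<in> poly_vertices (hpoly (E \<union> N))" using v E(2) by simp
        obtain y j where y: "(poly_adj (hpoly (E \<union> N)) ^^ j) v y" "y \<in> poly_vertices (hpoly (E \<union> N))"
          "\<And>z. z \<in> hpoly (E \<union> N) \<Longrightarrow> fst h \<bullet> z \<le> fst h \<bullet> y"
          by (rule reach_maximum[OF E(1) vS up]) (assumption, rule that)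
        have "P \<inter> {x. fst h \<bullet> x = snd h} \<noteq> {}" using facet_rep(4)[OF N h] by (auto simp: facet_of_def)
        then obtain z where "z \<in> P" "fst h \<bullet> z = snd h" by blast
        then have "snd h \<le> fst h \<bullet> y" using y(3)[of z] E(2) by simp
        then have "fst h \<bullet> y = snd h" using up[OF vertex_in[OF y(2)]] by linarith
        then have "h \<in> active N y" using h by (simp add: active_def)
        then show ?thesis using y E(2) by metis
      qed
      then obtain J where J: "\<And>h. h \<in> N \<Longrightarrow> \<exists>y. (poly_adj P ^^ J h) v y \<and> y \<in> poly_vertices P \<and> h \<in> active N y"
        by metis
      have "h \<in> R v (Max (J ` N))" if h: "h \<in> N" for h
      proof -
        have "J h \<le> Max (J ` N)" using fN h by simp
        then show ?thesis using J[OF h] h unfolding R_def by blast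
      qed
      then show ?thesis using Rsub by blast
    qed
    then have "\<exists>k. ?n div 2 < card (R v k)" using nN dn d by (metis div_less_dividend less_le_trans one_less_numeral_iff semiring_norm(76) zero_less_numeral)
    then obtain k where k: "?n div 2 < card (R v k)" "\<And>j. j < k \<Longrightarrow> \<not> ?n div 2 < card (R v j)"
      using exists_least_iff[of "\<lambda>k. ?n div 2 < card (R v k)"] by blast
    have "enat k \<le> dbound TYPE('a) d (?n div 2)"
    proof (cases k)
      case 0
      then show ?thesis by (simp add: zero_enat_def[symmetric])
    next
      case (Suc l)
      \<comment> \<open>\<open>l\<close> is the last radius at which at most half of the
        inequalities have been met, and these define the relaxation.\<close>
      let ?N = "R v l"
      define Q where "Q = ?A \<inter> hpoly ?N"
      have small: "card ?N \<le> ?n div 2" using k(2)[of l] Suc by simp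
      have frQ: "full_rep ?A ?N Q"
        using N(1) Rsub[of v l] finR[of v l] unfolding full_rep_def Q_def by blast
      have cQ: "card (facets Q) \<le> ?n div 2" using card_facets_le[OF frQ] small by linarith
      have "?N \<noteq> R v k" using k(1) small by auto
      moreover have "?N \<subseteq> R v k" unfolding R_def Suc by (blast intro: le_SucI)
      ultimately obtain h where h: "h \<in> R v k" "h \<notin> ?N" by blast
      then obtain j y where y: "j \<le> k" "(poly_adj P ^^ j) v y" "y \<in> poly_vertices P" "h \<in> active N y" "h \<in> N"
        unfolding R_def by blast
      have yd: "\<not> (poly_adj P ^^ i) v y" if "i \<le> l" for i using h(2) y that unfolding R_def by blast
      then have "j = Suc l" using y(1,2) Suc by (metis le_Suc_eq)
      \<comment> \<open>\<open>y\<close> meets the new inequality \<open>h\<close> and cannot be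
        reached within \<open>l\<close> steps, so its predecessor \<open>x\<close> has distance
        exactly \<open>l\<close> from \<open>v\<close>.\<close>
      then obtain x where x: "(poly_adj P ^^ l) v x" "poly_adj P x y" using y(2) by auto
      have xv: "x \<in> poly_vertices P" using poly_adj_vertices[OF x(2)] by blast
      have reach: "h \<in> ?N" if "j \<le> l" "(poly_adj P ^^ j) v y" "y \<in> poly_vertices P" "h \<in> active N y" for j y h
        using that active_subset[of N y] unfolding R_def by blast
      have rel1: "y \<in> poly_vertices Q" if "j \<le> l" "(poly_adj P ^^ j) v y" "y \<in> poly_vertices P" for j y
        by (rule path_in_relaxation(1)[OF N(1) frQ Rsub _ v that]) (rule reach)
      have rel2: "(poly_adj P ^^ j) v y \<and> y \<in> poly_vertices P" if "j \<le> l" "(poly_adj Q ^^ j) v y" for j y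
        by (rule path_in_relaxation(2)[OF N(1) frQ Rsub _ v that]) (rule reach)
      have vQ: "v \<in> poly_vertices Q" by (rule rel1[of 0]) (use v in auto)
      have xQ: "x \<in> poly_vertices Q" using rel1[OF _ x(1) xv] by simp
      \<comment> \<open>A shorter path in \<open>Q\<close> would be a path in \<open>P\<close> as
        well and would reach \<open>y\<close> too early. The \<open>+ 1\<close> in the induction
        hypothesis then pays for the step from \<open>l\<close> to \<open>k\<close>.\<close>
      have "enat l \<le> graph_dist Q v x"
      proof (rule graph_dist_geI, rule ccontr)
        fix i assume i: "(poly_adj Q ^^ i) v x" "\<not> enat l \<le> enat i"
        then have "(poly_adj P ^^ i) v x" using rel2[of i x] by simp
        then have "(poly_adj P ^^ Suc i) v y" using x(2) by (rule relpowp_Suc_I)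
        then show False using yd[of "Suc i"] i(2) by simp
      qed
      then have "enat k \<le> graph_dist Q v x + 1" using Suc by (metis eSuc_enat ile_eSuc plus_1_eSuc(2) eSuc_ile_mono)
      moreover have "card (facets Q) < ?n" using cQ dn d by linarith
      moreover have "aff_dim Q = int d" using full_rep_aff_dim[OF frQ] less.prems(2) by simp
      ultimately have "enat k \<le> dbound TYPE('a) d (card (facets Q))"
        using less.hyps[OF _ full_rep_polyhedron[OF frQ] _ vQ xQ] by (metis order_trans)
      also have "\<dots> \<le> dbound TYPE('a) d (?n div 2)" by (rule dbound_mono[OF d cQ])
      finally show ?thesis .
    qed
    then show ?thesis using k(1) by blast
  qed
  obtain k where k: "?n div 2 < card (R v k)" "enat k \<le> dbound TYPE('a) d (?n div 2)"
    using big[OF less.prems(3)] by blast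
  obtain l where l: "?n div 2 < card (R w l)" "enat l \<le> dbound TYPE('a) d (?n div 2)"
    using big[OF less.prems(4)] by blast
  \<comment> \<open>Two sets of more than half of the inequalities meet; a common inequality
    supplies a facet reached from both ends.\<close>
  have "R v k \<inter> R w l \<noteq> {}"
  proof
    assume "R v k \<inter> R w l = {}"
    then have "card (R v k) + card (R w l) = card (R v k \<union> R w l)" using card_Un_disjoint finR by metis
    also have "\<dots> \<le> ?n" unfolding nN using Rsub fN by (intro card_mono) auto
    finally show False using k(1) l(1) by linarith
  qed
  then obtain h where h: "h \<in> N" "h \<in> R v k" "h \<in> R w l" using Rsub by blast
  obtain i x where x: "i \<le> k" "(poly_adj P ^^ i) v x" "x \<in> poly_vertices P" "h \<in> active N x"
    using h(2) unfolding R_def by blast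
  obtain j y where y: "j \<le> l" "(poly_adj P ^^ j) w y" "y \<in> poly_vertices P" "h \<in> active N y"
    using h(3) unfolding R_def by blast
  let ?F = "P \<inter> {x. fst h \<bullet> x = snd h}"
  note F = facet_rep[OF N h(1)]
  have "x \<in> ?F" "y \<in> ?F" using x y vertex_in by (auto simp: active_def)
  then have xyF: "x \<in> poly_vertices ?F" "y \<in> poly_vertices ?F" using vertices_face[OF F(2)] x(3) y(3) by auto
  have "card (facets ?F) \<le> card (N - {h})" using card_facets_le[OF F(1)] .
  also have "\<dots> < ?n" unfolding nN using fN h(1) by (rule card_Diff1_less)
  finally have cF: "card (facets ?F) < ?n" .
  have "aff_dim ?F = int (d - 1)" using F(3) less.prems(2) d by simp
  \<comment> \<open>The facet has strictly fewer than \<open>?n\<close> facets, so strict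
    monotonicity absorbs the \<open>+ 1\<close>.\<close>
  then have FD: "graph_dist ?F x y + 1 \<le> Delta_u TYPE('a) (d - 1) ?n"
    using graph_dist_less_Delta[OF full_rep_polyhedron[OF F(1)] _ _ xyF cF] d by simp
  have "graph_dist P v w \<le> enat i + graph_dist P x y + enat j"
  proof -
    have gx: "graph_dist P x y = enat (vdist P x y)" "(poly_adj P ^^ vdist P x y) x y"
      using vdist[OF less.prems(1) x(3) y(3)] by auto
    have "(poly_adj P ^^ j) y w" using relpowp_sym[OF poly_adj_sym y(2)] .
    then have "(poly_adj P ^^ (i + vdist P x y + j)) v w"
      using x(2) gx(2) by (metis relcomppI relpowp_add)
    from graph_dist_le[OF this] show ?thesis by (simp add: gx(1))
  qed
  also have "\<dots> \<le> enat k + graph_dist ?F x y + enat l"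
    using x(1) y(1) graph_dist_face[OF F(2)] by (intro add_mono) auto
  finally have "graph_dist P v w + 1 \<le> enat k + (graph_dist ?F x y + 1) + enat l"
    by (metis (no_types, lifting) add.assoc add.commute add_right_mono)
  also have "\<dots> \<le> dbound TYPE('a) d (?n div 2) + Delta_u TYPE('a) (d - 1) ?n + dbound TYPE('a) d (?n div 2)"
    by (intro add_mono k(2) l(2) FD)
  also have "\<dots> = dbound TYPE('a) d ?n"
    unfolding dbound.simps[of _ d ?n] using dn d by (simp add: mult_2 ac_simps)
  finally show ?case using dn by blast
qed

text \<open>The exponent is the \<open>k\<close> with
  \<open>d * 2 ^ k \<le> n < d * 2 ^ (k + 1)\<close>. Both bounds are even multiples for
  \<open>k > 0\<close>, so rounding down in \<open>n div 2\<close> does not disturb them.\<close>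

lemma floor_log_div:
  assumes "0 < d" "2 * d \<le> n"
  shows "nat \<lfloor>log 2 (real n / real d)\<rfloor> = Suc (nat \<lfloor>log 2 (real (n div 2) / real d)\<rfloor>)"
proof -
  have eq: "nat \<lfloor>log 2 (real n / real d)\<rfloor> = k \<longleftrightarrow> d * 2 ^ k \<le> n \<and> n < d * 2 ^ Suc k" if "d \<le> n" for n k
  proof -
    have "1 \<le> real n / real d" using that assms(1) by simp
    then have "0 \<le> \<lfloor>log 2 (real n / real d)\<rfloor>" by simp
    then have "nat \<lfloor>log 2 (real n / real d)\<rfloor> = k \<longleftrightarrow> \<lfloor>log 2 (real n / real d)\<rfloor> = int k" by auto
    also have "\<dots> \<longleftrightarrow> 2 powr int k \<le> real n / real d \<and> real n / real d < 2 powr (int k + 1)"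
      using that assms(1) by (subst floor_log_eq_powr_iff) auto
    also have "2 powr int k = (2::real) ^ k" by (simp add: powr_realpow)
    also have "2 powr (int k + 1) = (2::real) ^ Suc k"
      using powr_realpow[of 2 "Suc k"] by (simp add: add.commute)
    also have "(2 ^ k \<le> real n / real d \<and> real n / real d < 2 ^ Suc k) \<longleftrightarrow>
        real (d * 2 ^ k) \<le> real n \<and> real n < real (d * 2 ^ Suc k)"
      using assms(1) by (simp add: pos_le_divide_eq pos_divide_less_eq mult.commute)
    finally show ?thesis unfolding of_nat_le_iff of_nat_less_iff .
  qed
  define k where "k = nat \<lfloor>log 2 (real (n div 2) / real d)\<rfloor>"
  have "d \<le> n div 2" using assms by linarith
  then have "d * 2 ^ k \<le> n div 2" "n div 2 < d * 2 ^ Suc k" using eq[of "n div 2" k] k_def by auto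
  then have "d * 2 ^ Suc k \<le> n" "n < d * 2 ^ Suc (Suc k)" by auto
  then show ?thesis using eq[of n "Suc k"] assms k_def by simp
qed

lemma floor_log_less_double:
  assumes "d \<le> n" "n < 2 * d"
  shows "nat \<lfloor>log 2 (real n / real d)\<rfloor> = 0"
proof -
  have d: "0 < d" using assms by linarith
  have "1 \<le> real n / real d" "real n / real d < 2" using assms d by (auto simp: pos_divide_less_eq)
  then have "log 2 (real n / real d) < log 2 2" by (subst log_less_cancel_iff) auto
  then show ?thesis by (simp add: floor_le_iff)
qed

lemma ereal_of_enat_double: "ereal_of_enat (2 * x) = 2 * ereal_of_enat x"
  by (cases x) (auto simp: numeral_eq_enat)

text \<open>Iterated halving composes to \<open>n div 2 ^ i\<close>, the factors 2 accumulate to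
  \<open>2 ^ i\<close>, and the recursion stops exactly when the quotient falls below
  \<open>d\<close>.\<close>

lemma ereal_dbound:
  assumes "0 < d" "d \<le> n"
  shows "ereal_of_enat (dbound TYPE('a::euclidean_space) d n) =
    (\<Sum>i = 0..nat \<lfloor>log 2 (real n / real d)\<rfloor>. 2 ^ i * ereal_of_enat (Delta_u TYPE('a) (d - 1) (n div 2 ^ i)))"
  using assms(2)
proof (induction n rule: less_induct)
  case (less n)
  show ?case
  proof (cases "2 * d \<le> n")
    case True
    let ?k = "nat \<lfloor>log 2 (real (n div 2) / real d)\<rfloor>"
    let ?f = "\<lambda>i. 2 ^ i * ereal_of_enat (Delta_u TYPE('a) (d - 1) (n div 2 ^ i))"
    let ?g = "\<lambda>i. 2 ^ i * ereal_of_enat (Delta_u TYPE('a) (d - 1) (n div 2 div 2 ^ i))"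
    have "(\<Sum>i = 0..Suc ?k. ?f i) = ?f 0 + (\<Sum>i = 0..?k. ?f (Suc i))"
      by (subst sum.atLeast0_atMost_Suc_shift) simp
    also have "(\<Sum>i = 0..?k. ?f (Suc i)) = (\<Sum>i = 0..?k. 2 * ?g i)"
      by (intro sum.cong refl) (simp only: power_Suc mult.assoc div_mult2_eq)
    also have "\<dots> = 2 * (\<Sum>i = 0..?k. ?g i)"
      by (intro sum_ereal_right_distrib[symmetric]) (simp add: ereal_of_enat_nonneg)
    also have "(\<Sum>i = 0..?k. ?g i) = ereal_of_enat (dbound TYPE('a) d (n div 2))"
      using True assms(1) by (intro less.IH[symmetric]) auto
    finally have "(\<Sum>i = 0..Suc ?k. ?f i) = ereal_of_enat (dbound TYPE('a) d n)"
      unfolding dbound.simps[of _ d n] using less.prems assms(1)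
      by (simp add: ereal_of_enat_add ereal_of_enat_double)
    then show ?thesis unfolding floor_log_div[OF assms(1) True] by simp
  next
    case False
    then have "nat \<lfloor>log 2 (real n / real d)\<rfloor> = 0" using less.prems by (intro floor_log_less_double) auto
    moreover have "dbound TYPE('a) d (n div 2) = 0" 
    proof -
      have "n div 2 < d" using False by linarith
      then show ?thesis by (subst dbound.simps) simp
    qed
    ultimately show ?thesis unfolding dbound.simps[of _ d n] using less.prems assms(1) by simp
  qed
qed

theorem theorem6p2:
  fixes d n :: nat
  assumes "d \<le> DIM('a::euclidean_space)"
    and "3 \<le> d" and "d \<le> n"
  shows "ereal_of_enat (Delta_u TYPE('a) d n)
    \<le> (\<Sum>i = 0..nat \<lfloor>log 2 (real n / real d)\<rfloor>.
          2 ^ i * ereal_of_enat (Delta_u TYPE('a) (d - 1) (n div 2 ^ i))) - 1"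
proof -
  let ?B = "dbound TYPE('a) d n"
  \<comment> \<open>The bound must be at least 1 for truncated subtraction on \<open>enat\<close> to
    agree with subtraction on \<open>ereal\<close>.\<close>
  have "1 \<le> Delta_u TYPE('a) (d - 1) n" using assms by (intro Delta_u_pos) auto
  also have "\<dots> \<le> ?B" unfolding dbound.simps[of _ d n] using assms(2,3) by simp
  finally have B1: "1 \<le> ?B" .
  have dist: "graph_dist P v w \<le> ?B - 1"
    if "P \<in> polyhedra d n" "v \<in> poly_vertices P" "w \<in> poly_vertices P" for P :: "'a set" and v w
  proof -
    have "graph_dist P v w + 1 \<le> ?B"
      using graph_dist_dbound[OF assms(2), of P v w] that by (simp add: polyhedra_def facets_def)
    then show ?thesis by (cases "graph_dist P v w"; cases ?B) (auto simp: one_enat_def)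
  qed
  have "Delta_u TYPE('a) d n \<le> ?B - 1"
    unfolding Delta_u_def[of _ d n] graph_diameter_def by (intro SUP_least dist)
  then have "ereal_of_enat (Delta_u TYPE('a) d n) \<le> ereal_of_enat (?B - 1)" by simp
  also have "\<dots> = ereal_of_enat ?B - 1"
    using B1 by (cases ?B) (auto simp: one_enat_def one_ereal_def of_nat_diff)
  also have "ereal_of_enat ?B = (\<Sum>i = 0..nat \<lfloor>log 2 (real n / real d)\<rfloor>.
          2 ^ i * ereal_of_enat (Delta_u TYPE('a) (d - 1) (n div 2 ^ i)))"
    using assms by (intro ereal_dbound) auto
  finally show ?thesis .
qed

end
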